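(* Let $n\geqslant 4$ and $m=\lfloor\frac{n-1}{2}\rfloor$. Let $B=\{x,y,e_2,\ldots,e_{n-1},x_1,\ldots,x_m,y_1,\ldots,y_m\}$ be an alphabet (of $2n-\frac{3+(-1)^n}{2}$ letters) and let $V$ consist of the following $\frac12\bigl(5n^2-(1+2(-1)^n)n+(-1)^{n+1}-3\bigr)$ monoid relations on $B^*$: $(V_1)$ $e_i^2=e_i$, for $2\leqslant i\leqslant n-1$; $(V_2)$ $xyx=x$ and $yxy=y$; $(V_3)$ $yx^2y=xy^2x$; $(V_4)$ $e_ie_j=e_je_i$, for $2\leqslant i<j\leqslant n-1$; $(V_5)$ $xye_i=e_ixy$ and $yxe_i=e_iyx$, for $2\leqslant i\leqslant n-1$; $(V_6)$ $xe_{i+1}=e_ix$, for $2\leqslant i\leqslant n-2$; $(V_7)$ $x^2y=e_{n-1}x$ and $yx^2=xe_2$; $(V_8)$ $yxe_2\cdots e_{n-1}xy=xe_2\cdots e_{n-1}xy$; $(V_9)$ $x_iy_i=e_2\cdots e_ie_{i+2}\cdots e_{n-1}xy$, for $1\leqslant i\leqslant m$; $y_1x_1=e_2\cdots e_{n-1}$; $y_ix_i=e_2\cdots e_{n-i}e_{n-i+2}\cdots e_{n-1}xy$, for $2\leqslant i\leqslant m$; $(V_{10})$ $x_ie_j=x_i$ and $e_jy_i=y_i$, for $1\leqslant i\leqslant m$, $2\leqslant j\leqslant n-1$, $j\neq n-i+1$; $(V_{11})$ $e_jx_i=x_i$ and $y_ie_j=y_i$, for $1\leqslant i\leqslant m$,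 $2\leqslant j\leqslant n-1$, $j\neq i+1$; $(V_{12})$ $x_ixy=xyx_i=x_i$ and $xyy_i=y_ixy=y_i$, for $2\leqslant i\leqslant m$; $xyx_1=x_1$ and $y_1xy=y_1$; $(V_{13})$ $yxx_1=x_1yx=x^{n-2}e_{n-1}$; $yxx_i=x_iyx=x^{n-2i}e_{n-2i+1}\cdots e_{n-i}e_{n-i+2}\cdots e_{n-1}xy$, for $2\leqslant i\leqslant m$; $yxy_i=y_iyx=y^{n-2i+1}xe_2\cdots e_ie_{i+2}\cdots e_{2i}$, for $1\leqslant i\leqslant m$; $(V_{14})$ $x_1xy=e_2x_1=y_1e_2=xyy_1=e_2\cdots e_{n-1}xy$; $x_ie_{n-i+1}=e_{i+1}x_i=y_ie_{i+1}=e_{n-i+1}y_i=e_2\cdots e_{n-1}xy$, for $2\leqslant i\leqslant m$. Then the monoid $\mathcal{ODI}_n$ is defined by the presentation $\langle B\mid V\rangle$.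
   Context: Let $\Omega_n=\{1<2<\cdots<n\}$. $\mathcal{I}_n$ is the symmetric inverse monoid of all partial permutations (injective partial maps) of $\Omega_n$ under composition; maps act on the right, so $\alpha\beta$ means first $\alpha$, then $\beta$. Let $g$ be the permutation $i\mapsto i+1$ ($1\leqslant i\leqslant n-1$), $n\mapsto 1$, and $h$ the permutation $i\mapsto n+1-i$; they generate the dihedral group $\mathcal{D}_{2n}$ of order $2n$ inside the symmetric group on $\Omega_n$. The dihedral inverse monoid $\mathcal{DI}_n$ is the submonoid of $\mathcal{I}_n$ of all restrictions (to arbitrary subsets of $\Omega_n$) of elements of $\mathcal{D}_{2n}$. An $\alpha\in\mathcal{I}_n$ is order-preserving if $a\leqslant b$ implies $a\alpha\leqslant b\alpha$ for all $a,b\in\mathrm{Dom}(\alpha)$. $\mathcal{ODI}_n$ is the monoid of all order-preserving elements of $\mathcal{DI}_n$. A monoid $M$ is defined by a presentation $\langle B\mid V\rangle$, where $V\subseteq B^*\times B^*$, if $M\cong B^*/\rho_V$, where $\rho_V$ is the smallest congruence on the free monoid $B^*$ containing $V$. Conventions: $e_a\cdots e_b$ denotes the product of the letters $e_k$, $a\leqslant k\leqslant b$, in increasing order of index, and is the empty word if $a>b$. A chain of $k$ equalities counts as $k$ relations. *)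

theory Defs
  imports Complex_Main "HOL-Algebra.Sym_Groups"
begin

section \<open>Monoid presentations\<close>

text \<open>The free monoid on an alphabet \<open>B\<close> is \<open>lists B\<close> under concatenation.\<close>

definition is_congruence :: "'b set \<Rightarrow> ('b list \<times> 'b list) set \<Rightarrow> bool" where
  "is_congruence B r \<longleftrightarrow> equiv (lists B) r \<and>
     (\<forall>u v u' v'. (u, v) \<in> r \<longrightarrow> (u', v') \<in> r \<longrightarrow> (u @ u', v @ v') \<in> r)"

definition generated_congruence ::
    "'b set \<Rightarrow> ('b list \<times> 'b list) set \<Rightarrow> ('b list \<times> 'b list) set" where
  "generated_congruence B V = \<Inter>{r. is_congruence B r \<and> V \<subseteq> r}"

text \<open>If \<open>V \<subseteq> lists B \<times> lists B\<close>, the union in the multiplication below is a single class,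
  since all the classes occurring in it coincide.\<close>

definition presented_monoid ::
    "'b set \<Rightarrow> ('b list \<times> 'b list) set \<Rightarrow> 'b list set monoid" where
  "presented_monoid B V =
     \<lparr>carrier = lists B // generated_congruence B V,
      mult = (\<lambda>C D. \<Union>u\<in>C. \<Union>v\<in>D. generated_congruence B V `` {u @ v}),
      one = generated_congruence B V `` {[]}\<rparr>"

text \<open>The relation \<open>\<cong>\<close> of HOL-Algebra asks for a bijective multiplicative map; between monoids,
  such a map automatically preserves the identity.\<close>

definition defined_by_presentation ::
    "('a, 'c) monoid_scheme \<Rightarrow> 'b set \<Rightarrow> ('b list \<times> 'b list) set \<Rightarrow> bool" where
  "defined_by_presentation M B V \<longleftrightarrow>
     monoid M \<and> V \<subseteq> lists B \<times> lists B \<and> M \<cong> presented_monoid B V"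

lemma is_congruence_generated:
  assumes "V \<subseteq> lists B \<times> lists B"
  shows "is_congruence B (generated_congruence B V)"
proof -
  let ?r = "generated_congruence B V"
  have full: "is_congruence B (lists B \<times> lists B)"
    by (auto simp: is_congruence_def equiv_def refl_on_def sym_def trans_def)
  have mem: "p \<in> ?r \<longleftrightarrow> (\<forall>r. is_congruence B r \<longrightarrow> V \<subseteq> r \<longrightarrow> p \<in> r)" for p
    by (auto simp: generated_congruence_def)
  have eqv: "equiv (lists B) r" if "is_congruence B r" for r
    using that by (simp add: is_congruence_def)
  have "equiv (lists B) ?r"
  proof (rule equivI)
    show "?r \<subseteq> lists B \<times> lists B"
      using full assms mem by blast
    show "refl_on (lists B) ?r"
      using eqv by (simp add: refl_on_def mem equiv_def)
    show "sym ?r"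
      by (rule symI) (metis mem eqv equiv_def symD)
    show "trans ?r"
      by (rule transI) (metis mem eqv equiv_def transD)
  qed
  moreover have "(u @ u', v @ v') \<in> ?r" if "(u, v) \<in> ?r" "(u', v') \<in> ?r" for u v u' v'
    using that unfolding mem by (simp add: is_congruence_def)
  ultimately show ?thesis
    by (simp add: is_congruence_def)
qed

lemma mult_presented_monoid:
  assumes "V \<subseteq> lists B \<times> lists B" and "u \<in> lists B" "v \<in> lists B"
  shows "(generated_congruence B V `` {u}) \<otimes>\<^bsub>presented_monoid B V\<^esub>
         (generated_congruence B V `` {v}) = generated_congruence B V `` {u @ v}"
proof -
  let ?r = "generated_congruence B V"
  have e: "equiv (lists B) ?r"
    and c: "\<And>u v u' v'. (u, v) \<in> ?r \<Longrightarrow> (u', v') \<in> ?r \<Longrightarrow> (u @ u', v @ v') \<in> ?r"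
    using is_congruence_generated[OF assms(1)] by (simp_all add: is_congruence_def)
  have eq: "?r `` {a @ b} = ?r `` {u @ v}" if "a \<in> ?r `` {u}" "b \<in> ?r `` {v}" for a b
    using equiv_class_eq[OF e c, of u a v b] that by simp
  have "u \<in> ?r `` {u}" "v \<in> ?r `` {v}"
    using equiv_class_self[OF e] assms(2,3) by simp_all
  then have "(\<Union>a\<in>?r `` {u}. \<Union>b\<in>?r `` {v}. ?r `` {a @ b}) = ?r `` {u @ v}"
    using eq by (meson UN_constant_eq)
  then show ?thesis
    by (simp add: presented_monoid_def)
qed

section \<open>The monoid of order-preserving partial permutations in the dihedral inverse monoid\<close>

text \<open>Maps act on the right: the product of \<open>\<alpha>\<close> and \<open>\<beta>\<close> is first \<open>\<alpha>\<close>, then \<open>\<beta>\<close>.\<close>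

definition sym_inv_monoid :: "nat \<Rightarrow> (nat \<rightharpoonup> nat) monoid" where
  "sym_inv_monoid n =
     \<lparr>carrier = {\<alpha>. dom \<alpha> \<subseteq> {1..n} \<and> ran \<alpha> \<subseteq> {1..n} \<and> inj_on \<alpha> (dom \<alpha>)},
      mult = (\<lambda>\<alpha> \<beta>. \<beta> \<circ>\<^sub>m \<alpha>),
      one = (\<lambda>i. if i \<in> {1..n} then Some i else None)\<rparr>"

text \<open>Elements of \<open>sym_group n\<close> are functions on all of \<open>nat\<close> that fix every point outside
  \<open>{1..n}\<close>. It composes maps from right to left, but the subgroup generated by a set is the
  same for either order of composition.\<close>

definition rotation :: "nat \<Rightarrow> nat \<Rightarrow> nat" where
  "rotation n i = (if i \<in> {1..n} then (if i = n then 1 else i + 1) else i)"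

definition reflection :: "nat \<Rightarrow> nat \<Rightarrow> nat" where
  "reflection n i = (if i \<in> {1..n} then n + 1 - i else i)"

definition dihedral :: "nat \<Rightarrow> (nat \<Rightarrow> nat) set" where
  "dihedral n = generate (sym_group n) {rotation n, reflection n}"

definition DI :: "nat \<Rightarrow> (nat \<rightharpoonup> nat) monoid" where
  "DI n = (sym_inv_monoid n)
     \<lparr>carrier := {(\<lambda>i. if i \<in> A then Some (\<sigma> i) else None) | \<sigma> A. \<sigma> \<in> dihedral n \<and> A \<subseteq> {1..n}}\<rparr>"

definition order_preserving :: "(nat \<rightharpoonup> nat) \<Rightarrow> bool" where
  "order_preserving \<alpha> \<longleftrightarrow>
     (\<forall>a\<in>dom \<alpha>. \<forall>b\<in>dom \<alpha>. a \<le> b \<longrightarrow> the (\<alpha> a) \<le> the (\<alpha> b))"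

definition ODI :: "nat \<Rightarrow> (nat \<rightharpoonup> nat) monoid" where
  "ODI n = (DI n)\<lparr>carrier := {\<alpha> \<in> carrier (DI n). order_preserving \<alpha>}\<rparr>"

section \<open>The alphabet and the relations\<close>

text \<open>The letters \<open>x\<close>, \<open>y\<close>, \<open>e\<^sub>i\<close>, \<open>x\<^sub>i\<close>, \<open>y\<^sub>i\<close> are written \<open>X\<close>, \<open>Y\<close>, \<open>E i\<close>, \<open>Xs i\<close>, \<open>Ys i\<close>.\<close>

datatype letter = X | Y | E nat | Xs nat | Ys nat

definition m_of :: "nat \<Rightarrow> nat" where
  "m_of n = (n - 1) div 2"

definition alphabet :: "nat \<Rightarrow> letter set" where
  "alphabet n = {X, Y} \<union> E ` {2..n - 1} \<union> Xs ` {1..m_of n} \<union> Ys ` {1..m_of n}"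

text \<open>\<open>Es a b\<close> is the word \<open>e\<^sub>a \<cdots> e\<^sub>b\<close>, which is empty if \<open>a > b\<close>.\<close>

definition Es :: "nat \<Rightarrow> nat \<Rightarrow> letter list" where
  "Es a b = map E [a..<b + 1]"

text \<open>\<open>chain [w\<^sub>0, \<dots>, w\<^sub>k]\<close> consists of the relations \<open>w\<^sub>0 = w\<^sub>1\<close>, \dots, \<open>w\<^bsub>k-1\<^esub> = w\<^sub>k\<close>.\<close>

definition chain :: "'b list list \<Rightarrow> ('b list \<times> 'b list) set" where
  "chain ws = set (zip ws (tl ws))"

definition V1 :: "nat \<Rightarrow> (letter list \<times> letter list) set" where
  "V1 n = (\<Union>i\<in>{2..n - 1}. chain [[E i, E i], [E i]])"

definition V2 :: "(letter list \<times> letter list) set" where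
  "V2 = chain [[X, Y, X], [X]] \<union> chain [[Y, X, Y], [Y]]"

definition V3 :: "(letter list \<times> letter list) set" where
  "V3 = chain [[Y, X, X, Y], [X, Y, Y, X]]"

definition V4 :: "nat \<Rightarrow> (letter list \<times> letter list) set" where
  "V4 n = (\<Union>j\<in>{2..n - 1}. \<Union>i\<in>{2..<j}. chain [[E i, E j], [E j, E i]])"

definition V5 :: "nat \<Rightarrow> (letter list \<times> letter list) set" where
  "V5 n = (\<Union>i\<in>{2..n - 1}.
     chain [[X, Y, E i], [E i, X, Y]] \<union> chain [[Y, X, E i], [E i, Y, X]])"

definition V6 :: "nat \<Rightarrow> (letter list \<times> letter list) set" where
  "V6 n = (\<Union>i\<in>{2..n - 2}. chain [[X, E (i + 1)], [E i, X]])"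

definition V7 :: "nat \<Rightarrow> (letter list \<times> letter list) set" where
  "V7 n = chain [[X, X, Y], [E (n - 1), X]] \<union> chain [[Y, X, X], [X, E 2]]"

definition V8 :: "nat \<Rightarrow> (letter list \<times> letter list) set" where
  "V8 n = chain [[Y, X] @ Es 2 (n - 1) @ [X, Y], [X] @ Es 2 (n - 1) @ [X, Y]]"

definition V9 :: "nat \<Rightarrow> (letter list \<times> letter list) set" where
  "V9 n =
     (\<Union>i\<in>{1..m_of n}. chain [[Xs i, Ys i], Es 2 i @ Es (i + 2) (n - 1) @ [X, Y]]) \<union>
     chain [[Ys 1, Xs 1], Es 2 (n - 1)] \<union>
     (\<Union>i\<in>{2..m_of n}.
        chain [[Ys i, Xs i], Es 2 (n - i) @ Es (n - i + 2) (n - 1) @ [X, Y]])"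

definition V10 :: "nat \<Rightarrow> (letter list \<times> letter list) set" where
  "V10 n = (\<Union>i\<in>{1..m_of n}. \<Union>j\<in>{2..n - 1} - {n - i + 1}.
     chain [[Xs i, E j], [Xs i]] \<union> chain [[E j, Ys i], [Ys i]])"

definition V11 :: "nat \<Rightarrow> (letter list \<times> letter list) set" where
  "V11 n = (\<Union>i\<in>{1..m_of n}. \<Union>j\<in>{2..n - 1} - {i + 1}.
     chain [[E j, Xs i], [Xs i]] \<union> chain [[Ys i, E j], [Ys i]])"

definition V12 :: "nat \<Rightarrow> (letter list \<times> letter list) set" where
  "V12 n =
     (\<Union>i\<in>{2..m_of n}.
        chain [[Xs i, X, Y], [X, Y, Xs i], [Xs i]] \<union>
        chain [[X, Y, Ys i], [Ys i, X, Y], [Ys i]]) \<union>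
     chain [[X, Y, Xs 1], [Xs 1]] \<union> chain [[Ys 1, X, Y], [Ys 1]]"

definition V13 :: "nat \<Rightarrow> (letter list \<times> letter list) set" where
  "V13 n =
     chain [[Y, X, Xs 1], [Xs 1, Y, X], replicate (n - 2) X @ [E (n - 1)]] \<union>
     (\<Union>i\<in>{2..m_of n}.
        chain [[Y, X, Xs i], [Xs i, Y, X],
               replicate (n - 2 * i) X @ Es (n - 2 * i + 1) (n - i) @
                 Es (n - i + 2) (n - 1) @ [X, Y]]) \<union>
     (\<Union>i\<in>{1..m_of n}.
        chain [[Y, X, Ys i], [Ys i, Y, X],
               replicate (n - 2 * i + 1) Y @ [X] @ Es 2 i @ Es (i + 2) (2 * i)])"

definition V14 :: "nat \<Rightarrow> (letter list \<times> letter list) set" where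
  "V14 n =
     chain [[Xs 1, X, Y], [E 2, Xs 1], [Ys 1, E 2], [X, Y, Ys 1], Es 2 (n - 1) @ [X, Y]] \<union>
     (\<Union>i\<in>{2..m_of n}.
        chain [[Xs i, E (n - i + 1)], [E (i + 1), Xs i], [Ys i, E (i + 1)],
               [E (n - i + 1), Ys i], Es 2 (n - 1) @ [X, Y]])"

definition relations :: "nat \<Rightarrow> (letter list \<times> letter list) set" where
  "relations n = V1 n \<union> V2 \<union> V3 \<union> V4 n \<union> V5 n \<union> V6 n \<union> V7 n \<union> V8 n \<union> V9 n \<union>
     V10 n \<union> V11 n \<union> V12 n \<union> V13 n \<union> V14 n"

end

theory Submission
  imports Defs
begin

text \<open>Put \<open>e\<^sub>1 = yx\<close> and \<open>e\<^sub>n = xy\<close>. Then \<open>(V\<^sub>1)\<close>--\<open>(V\<^sub>8)\<close> say that the \<open>e\<^sub>i\<close> are commuting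
  idempotents moved by one step by \<open>x\<close> and \<open>y\<close>, and every word in these letters reduces to
  \<open>e\<^sub>A x\<^sup>k\<close> or \<open>e\<^sub>A y\<^sup>k\<close>, a partial translation. Writing \<open>f\<^sub>d\<close> for \<open>x\<^sub>d\<close> if \<open>2d < n\<close> and for
  \<open>y\<^bsub>n-d\<^esub>\<close> if \<open>2d > n\<close>, so that \<open>f\<^sub>d\<close> stands for \<open>1 \<mapsto> 1, d + 1 \<mapsto> n - d + 1\<close>, the relations
  \<open>(V\<^sub>9)\<close>--\<open>(V\<^sub>1\<^sub>4)\<close> become uniform in \<open>d\<close>: each \<open>e\<^sub>j\<close> next to \<open>f\<^sub>d\<close> is either absorbed or turns the
  product into a translation, and \<open>f\<^sub>d f\<^sub>c\<close> is a translation or \<open>f\<^sub>d\<close> followed by one. Hence the set of words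
  equivalent to a translation or to some \<open>y\<^sup>a f\<^sub>d x\<^sup>c\<close> with \<open>a + d < n\<close>, \<open>c < d\<close> is closed under right
  multiplication by letters. These normal forms are separated by the partial maps that they
  represent, and an order-preserving restriction of a dihedral permutation is either a partial
  translation or, coming from a reflection, has rank 2 and changes the distance \<open>d\<close> of its two
  points to \<open>n - d\<close>.\<close>

section \<open>A faithful representation of a quotient of a free monoid\<close>

text \<open>The quotient by a congruence acts on its classes by right multiplication. This embeds it
  into a type of class \<open>monoid_mult\<close>, although the congruence depends on a parameter.\<close>

typedef 'a endo = "UNIV :: ('a \<Rightarrow> 'a) set" morphisms apply_endo Endo
  by simp

setup_lifting type_definition_endo

instantiation endo :: (type) monoid_mult
begin

lift_definition one_endo :: "'a endo" is id .

text \<open>The left factor acts first, so that the product over a word applies its letters from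
  left to right.\<close>

lift_definition times_endo :: "'a endo \<Rightarrow> 'a endo \<Rightarrow> 'a endo" is "\<lambda>f g. g \<circ> f" .

instance
  by standard (transfer; auto)+

end

text \<open>Products are kept right-associated by \<open>mult.assoc\<close>; from an equation for
  \<open>a * b\<close> this makes a rewrite rule that still fires when further factors
  follow.\<close>

lemma mult_assoc_rule: "a * b = c \<Longrightarrow> a * (b * u) = c * (u :: 'a::monoid_mult)"
  by (simp flip: mult.assoc)

lemma congruence_faithful_representation:
  fixes B :: "'b set"
  assumes "is_congruence B r"
  obtains \<phi> :: "'b \<Rightarrow> 'b list set endo"
  where "\<And>u v. u \<in> lists B \<Longrightarrow> v \<in> lists B \<Longrightarrow>
    (u, v) \<in> r \<longleftrightarrow> prod_list (map \<phi> u) = prod_list (map \<phi> v)"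
proof -
  have e: "equiv (lists B) r"
    and c: "\<And>u v u' v'. (u, v) \<in> r \<Longrightarrow> (u', v') \<in> r \<Longrightarrow> (u @ u', v @ v') \<in> r"
    using assms by (simp_all add: is_congruence_def)
  have refl: "(u, u) \<in> r" if "u \<in> lists B" for u
    using e that by (simp add: equiv_def refl_on_def)
  \<comment> \<open>Outside the quotient every letter acts as the identity, so equality of two
    products is decided on the classes alone.\<close>
  define \<phi> where
    "\<phi> b = Endo (\<lambda>C. if C \<in> lists B // r then r `` ((\<lambda>u. u @ [b]) ` C) else C)" for b
  have one_letter: "apply_endo (\<phi> b) (r `` {u}) = r `` {u @ [b]}"
    if "u \<in> lists B" "b \<in> B" for u b
  proof -
    have "r `` ((\<lambda>u. u @ [b]) ` (r `` {u})) = r `` {u @ [b]}"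
    proof (intro equalityI subsetI)
      fix v assume "v \<in> r `` ((\<lambda>u. u @ [b]) ` (r `` {u}))"
      then obtain t where t: "(u, t) \<in> r" "(t @ [b], v) \<in> r"
        by auto
      have "(u @ [b], t @ [b]) \<in> r"
        using c[OF t(1) refl[of "[b]"]] that by simp
      then show "v \<in> r `` {u @ [b]}"
        using t(2) e by (auto simp: equiv_def dest: transD)
    qed (use refl that in auto)
    then show ?thesis
      using that by (simp add: \<phi>_def Endo_inverse quotientI)
  qed
  have word: "apply_endo (prod_list (map \<phi> w)) (r `` {u}) = r `` {u @ w}"
    if "w \<in> lists B" "u \<in> lists B" for u w
    using that
  proof (induction w arbitrary: u)
    case (Cons b w)
    then show ?case
      using one_letter[of u b] Cons.IH[of "u @ [b]"] by (simp add: times_endo.rep_eq)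
  qed (simp add: one_endo.rep_eq)
  have other: "apply_endo (prod_list (map \<phi> w)) C = C" if "C \<notin> lists B // r" for w C
    using that by (induction w) (simp_all add: one_endo.rep_eq times_endo.rep_eq \<phi>_def Endo_inverse)
  have "(u, v) \<in> r \<longleftrightarrow> prod_list (map \<phi> u) = prod_list (map \<phi> v)"
    if uv: "u \<in> lists B" "v \<in> lists B" for u v
  proof
    assume uv': "(u, v) \<in> r"
    have "apply_endo (prod_list (map \<phi> u)) C = apply_endo (prod_list (map \<phi> v)) C" for C
    proof (cases "C \<in> lists B // r")
      case True
      then obtain w where w: "w \<in> lists B" "C = r `` {w}"
        by (meson quotientE)
      have "(w @ u, w @ v) \<in> r"
        using c refl w uv' by blast
      then show ?thesis
        using w uv word equiv_class_eq[OF e] by simp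
    qed (simp add: other)
    then show "prod_list (map \<phi> u) = prod_list (map \<phi> v)"
      by (simp add: apply_endo_inject[symmetric] fun_eq_iff)
  next
    \<comment> \<open>Acting on the class of the empty word recovers the class of the acting word,
      which gives faithfulness.\<close>
    assume "prod_list (map \<phi> u) = prod_list (map \<phi> v)"
    then have "r `` {u} = r `` {v}"
      using word[of u "[]"] word[of v "[]"] uv by simp
    then show "(u, v) \<in> r"
      using uv e by (simp add: eq_equiv_class_iff)
  qed
  then show ?thesis
    using that by blast
qed

section \<open>Normal forms\<close>

definition idem_word :: "nat \<Rightarrow> nat \<Rightarrow> letter list" where
  "idem_word n j = (if j = 1 then [Y, X] else if j = n then [X, Y] else [E j])"

definition flip_letter :: "nat \<Rightarrow> nat \<Rightarrow> letter" where
  "flip_letter n d = (if 2 * d < n then Xs d else Ys (n - d))"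

definition up_word :: "nat \<Rightarrow> nat list \<Rightarrow> nat \<Rightarrow> letter list" where
  "up_word n l k = concat (map (idem_word n) l) @ replicate k X"

definition down_word :: "nat \<Rightarrow> nat list \<Rightarrow> nat \<Rightarrow> letter list" where
  "down_word n l k = concat (map (idem_word n) l) @ replicate k Y"

definition flip_word :: "nat \<Rightarrow> nat \<Rightarrow> nat \<Rightarrow> nat \<Rightarrow> letter list" where
  "flip_word n a d c = replicate a Y @ [flip_letter n d] @ replicate c X"

text \<open>The forms are redundant: \<open>l\<close> may repeat entries or list points outside the
  domain of the shift, \<open>k\<close> may exceed \<open>n\<close>, and shift 0 occurs in both
  families. \<open>ev_trans_cong\<close> shows that this does no harm.\<close>

definition trans_words :: "nat \<Rightarrow> letter list set" where
  "trans_words n = {up_word n l k | l k. set l \<subseteq> {1..n}} \<union> {down_word n l k | l k. set l \<subseteq> {1..n}}"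

text \<open>The word represents the map with \<open>a + 1\<close> to \<open>c + 1\<close> and
  \<open>a + d + 1\<close> to \<open>n - d + c + 1\<close>; the bounds say that all four points lie
  in \<open>{1..n}\<close>. For \<open>2 * d = n\<close> the distance would be kept, and such a map
  is already a translation.\<close>

definition flip_words :: "nat \<Rightarrow> letter list set" where
  "flip_words n = {flip_word n a d c | a d c. 1 \<le> d \<and> 2 * d \<noteq> n \<and> a + d < n \<and> c < d}"

lemma set_Es: "set (Es a b) = E ` {a..b}"
  by (simp add: Es_def atLeastLessThanSuc_atLeastAtMost del: upt_Suc)

lemma Es_trivial: "Es 2 1 = []" "Es (1 + 2) (2 * 1) = []"
  by (simp_all add: Es_def)

text \<open>The computations take place in an arbitrary monoid in which the relations hold. Taking
  for \<open>\<phi>\<close> the faithful representation of the presented monoid turns equality of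
  values into congruence of words.\<close>

locale ODI_relations =
  fixes n :: nat and \<phi> :: "letter \<Rightarrow> 'a::monoid_mult"
  assumes n4: "4 \<le> n"
    and rel: "(u, v) \<in> relations n \<Longrightarrow> prod_list (map \<phi> u) = prod_list (map \<phi> v)"
begin

text \<open>Keeps \<open>e 1\<close> from being rewritten to \<open>e (Suc 0)\<close>.\<close>
declare One_nat_def [simp del]

definition ev :: "letter list \<Rightarrow> 'a" where "ev w = prod_list (map \<phi> w)"
definition x :: 'a where "x = \<phi> X"
definition y :: 'a where "y = \<phi> Y"
definition e :: "nat \<Rightarrow> 'a" where "e j = ev (idem_word n j)"
definition f :: "nat \<Rightarrow> 'a" where "f d = \<phi> (flip_letter n d)"
definition P :: "nat list \<Rightarrow> 'a" where "P l = prod_list (map e l)"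

lemma ev_Nil [simp]: "ev [] = 1"
  and ev_Cons: "ev (b # w) = \<phi> b * ev w"
  and ev_append: "ev (u @ v) = ev u * ev v"
  by (simp_all add: ev_def)

lemma P_Nil [simp]: "P [] = 1"
  and P_Cons: "P (j # l) = e j * P l"
  and P_append: "P (l @ l') = P l * P l'"
  by (simp_all add: P_def)

lemma ev_replicate: "ev (replicate k b) = \<phi> b ^ k"
  by (induction k) (simp_all add: ev_Cons)

lemma ev_idem_words: "ev (concat (map (idem_word n) l)) = P l"
  by (induction l) (simp_all add: ev_append P_Cons e_def)

lemma ev_up_word: "ev (up_word n l k) = P l * x ^ k"
  and ev_down_word: "ev (down_word n l k) = P l * y ^ k"
  and ev_flip_word: "ev (flip_word n a d c) = y ^ a * f d * x ^ c"
  by (simp_all add: up_word_def down_word_def flip_word_def ev_append ev_Cons ev_replicate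
      ev_idem_words x_def y_def f_def mult.assoc)

lemma ev_rel: "(u, v) \<in> relations n \<Longrightarrow> ev u = ev v"
  using rel by (simp add: ev_def)

lemma e_1: "e 1 = y * x"
  and e_n: "e n = x * y"
  and e_mid: "\<And>j. j \<in> {2..n - 1} \<Longrightarrow> e j = \<phi> (E j)"
  using n4 by (auto simp: e_def idem_word_def x_def y_def ev_Cons)

lemma ev_Es:
  assumes "2 \<le> a" "b \<le> n - 1"
  shows "ev (Es a b) = P [a..<b + 1]"
proof -
  have "map \<phi> (map E [a..<b + 1]) = map e [a..<b + 1]"
    using assms e_mid by (simp del: upt_Suc)
  then show ?thesis
    by (simp add: ev_def P_def Es_def del: upt_Suc map_map)
qed

lemmas ev_simps = ev_Cons ev_append x_def[symmetric] y_def[symmetric] mult.assoc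

section \<open>Idempotents and their passage through powers of \<open>x\<close> and
  \<open>y\<close>\<close>

lemma xyx: "x * y * x = x" and yxy: "y * x * y = y"
  using ev_rel[of "[X, Y, X]" "[X]"] ev_rel[of "[Y, X, Y]" "[Y]"]
  by (simp_all add: relations_def V2_def chain_def ev_simps)

lemma yxxy: "y * x * x * y = x * y * y * x"
  using ev_rel[of "[Y, X, X, Y]" "[X, Y, Y, X]"]
  by (simp add: relations_def V3_def chain_def ev_simps)

lemma e_idem:
  assumes "j \<in> {1..n}"
  shows "e j * e j = e j"
proof -
  consider "j = 1" | "j = n" | "j \<in> {2..n - 1}"
    using assms by force
  then show ?thesis
  proof cases
    case 3
    then have "([E j, E j], [E j]) \<in> relations n"
      by (auto simp: relations_def V1_def chain_def)
    from ev_rel[OF this] 3 show ?thesis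
      by (simp add: ev_simps e_mid)
  qed (metis e_1 e_n mult.assoc xyx)+
qed

text \<open>(V4) covers two middle indices, (V5) an end and a middle index, and (V3) is the
  commutation of \<open>e 1\<close> with \<open>e n\<close>.\<close>

lemma e_comm:
  assumes "i \<in> {1..n}" "j \<in> {1..n}"
  shows "e i * e j = e j * e i"
proof -
  have mid: "e i * e j = e j * e i" if "i < j" "i \<in> {2..n - 1}" "j \<in> {2..n - 1}" for i j
  proof -
    have "([E i, E j], [E j, E i]) \<in> relations n"
      using that by (auto simp: relations_def V4_def chain_def)
    from ev_rel[OF this] that show ?thesis
      by (simp add: ev_simps e_mid)
  qed
  have ends: "e 1 * e j = e j * e 1" "e n * e j = e j * e n" if "j \<in> {2..n - 1}" for j
  proof -
    have "([Y, X, E j], [E j, Y, X]) \<in> relations n" "([X, Y, E j], [E j, X, Y]) \<in> relations n"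
      using that by (auto simp: relations_def V5_def chain_def)
    from this[THEN ev_rel] that show "e 1 * e j = e j * e 1" "e n * e j = e j * e n"
      by (simp_all add: ev_simps e_mid e_1 e_n)
  qed
  have "e 1 * e n = e n * e 1"
    using yxxy by (simp add: e_1 e_n mult.assoc)
  moreover have "(i = 1 \<or> i = n \<or> i \<in> {2..n - 1}) \<and> (j = 1 \<or> j = n \<or> j \<in> {2..n - 1})"
    using assms by force
  moreover have "e i * e j = e j * e i" if "i \<in> {2..n - 1}" "j \<in> {2..n - 1}"
    using mid[of i j] mid[of j i] that by (cases i j rule: linorder_cases) simp_all
  ultimately show ?thesis
    using ends[of i] ends[of j] by (elim conjE disjE) simp_all
qed

lemma e_n_x: "e n * x = x" and x_e_1: "x * e 1 = x"
  and e_1_y: "e 1 * y = y" and y_e_n: "y * e n = y"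
  using xyx yxy by (simp_all add: e_1 e_n mult.assoc)

text \<open>(V6) covers the middle indices; the two relations of (V7) are the end cases
  \<open>i = 1\<close> and \<open>i = n - 1\<close> once \<open>yx\<close> and \<open>xy\<close> are
  read as idempotents.\<close>

lemma x_e:
  assumes "1 \<le> i" "i < n"
  shows "x * e (Suc i) = e i * x"
proof -
  consider "i = 1" | "i = n - 1" | "i \<in> {2..n - 2}"
    using assms by force
  then show ?thesis
  proof cases
    case 1
    have "([Y, X, X], [X, E 2]) \<in> relations n"
      by (auto simp: relations_def V7_def chain_def)
    from ev_rel[OF this] 1 n4 show ?thesis
      by (simp add: ev_simps e_mid e_1 flip: Suc_1)
  next
    case 2
    have "([X, X, Y], [E (n - 1), X]) \<in> relations n"
      by (auto simp: relations_def V7_def chain_def)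
    from ev_rel[OF this] 2 n4 show ?thesis
      by (simp add: ev_simps e_mid e_n)
  next
    case 3
    then have "([X, E (Suc i)], [E i, X]) \<in> relations n"
      by (auto simp: relations_def V6_def chain_def)
    from ev_rel[OF this] have "x * \<phi> (E (Suc i)) = \<phi> (E i) * x"
      by (simp add: ev_simps)
    moreover have "e i = \<phi> (E i)" "e (Suc i) = \<phi> (E (Suc i))"
      using 3 by (auto intro!: e_mid)
    ultimately show ?thesis
      by simp
  qed
qed

text \<open>(V6) and (V7) move idempotents past \<open>x\<close> only. For \<open>y\<close>, insert
  \<open>e n = xy\<close> behind the leading \<open>y\<close>, commute it past \<open>e i\<close>,
  apply \<open>x_e\<close>, and let the resulting \<open>e 1\<close> be absorbed by the last
  \<open>y\<close>.\<close>

lemma y_e: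
  assumes "1 \<le> i" "i < n"
  shows "y * e i = e (Suc i) * y"
proof -
  have "y * e i = y * (e n * e i)"
    by (metis y_e_n mult.assoc)
  also have "\<dots> = y * (e i * x) * y"
    using e_comm[of n i] assms by (simp add: e_n mult.assoc)
  also have "\<dots> = e 1 * e (Suc i) * y"
    using x_e[OF assms] by (simp add: e_1 mult.assoc)
  also have "\<dots> = e (Suc i) * y"
    using e_comm[of 1 "Suc i"] assms e_1_y by (simp add: mult.assoc)
  finally show ?thesis .
qed

lemma P_e_comm: "set l \<subseteq> {1..n} \<Longrightarrow> j \<in> {1..n} \<Longrightarrow> P l * e j = e j * P l"
proof (induction l)
  case (Cons i l)
  then show ?case
    using e_comm[of i j, THEN mult_assoc_rule] by (simp add: P_Cons mult.assoc)
qed simp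

lemma P_comm: "set l \<subseteq> {1..n} \<Longrightarrow> set l' \<subseteq> {1..n} \<Longrightarrow> P l * P l' = P l' * P l"
proof (induction l')
  case (Cons j l')
  then show ?case
    using P_e_comm[of l j, THEN mult_assoc_rule] by (simp add: P_Cons mult.assoc)
qed simp

lemma P_e_absorb: "set l \<subseteq> {1..n} \<Longrightarrow> j \<in> set l \<Longrightarrow> P l * e j = P l"
proof (induction l)
  case (Cons i l)
  show ?case
  proof (cases "j \<in> set l")
    case True
    then show ?thesis
      using Cons by (simp add: P_Cons mult.assoc)
  next
    case False
    then have "P (i # l) * e j = e i * (e i * P l)"
      using Cons.prems by (simp add: P_Cons P_e_comm mult.assoc)
    then show ?thesis
      using Cons.prems by (simp add: P_Cons e_idem mult.assoc[symmetric])
  qed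
qed simp

lemma P_absorb: "set l \<subseteq> {1..n} \<Longrightarrow> set l' \<subseteq> set l \<Longrightarrow> P l * P l' = P l"
proof (induction l')
  case (Cons j l')
  then show ?case
    using P_e_absorb[of l j] by (simp add: P_Cons flip: mult.assoc)
qed simp

text \<open>Each of the two products of commuting idempotents absorbs the other.\<close>

lemma P_cong:
  assumes "set l = set l'" "set l \<subseteq> {1..n}"
  shows "P l = P l'"
proof -
  have "P l = P l * P l'" "P l' = P l' * P l"
    using assms by (simp_all add: P_absorb)
  then show ?thesis
    using P_comm[of l l'] assms by simp
qed

lemma P_fix: "(\<And>j. j \<in> set l \<Longrightarrow> e j * t = t) \<Longrightarrow> P l * t = t"
  by (induction l) (simp_all add: P_Cons mult.assoc)

lemma P_x: "set l \<subseteq> {1..<n} \<Longrightarrow> P l * x = x * P (map Suc l)"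
proof (induction l)
  case (Cons i l)
  then show ?case
    using x_e[of i, THEN mult_assoc_rule] by (simp add: P_Cons mult.assoc)
qed simp

lemma y_P: "set l \<subseteq> {1..<n} \<Longrightarrow> y * P l = P (map Suc l) * y"
proof (induction l)
  case (Cons i l)
  then show ?case
    using y_e[of i, THEN mult_assoc_rule] by (simp add: P_Cons mult.assoc)
qed simp

lemma x_pow_e: "1 \<le> j \<Longrightarrow> j + k \<le> n \<Longrightarrow> x ^ k * e (j + k) = e j * x ^ k"
proof (induction k)
  case (Suc k)
  have "x ^ Suc k * e (j + Suc k) = x ^ k * (x * e (Suc (j + k)))"
    by (simp add: power_Suc2 mult.assoc del: power_Suc)
  also have "\<dots> = x ^ k * e (j + k) * x"
    using x_e[of "j + k"] Suc.prems by (simp add: mult.assoc)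
  also have "\<dots> = e j * x ^ Suc k"
    using Suc by (simp add: power_Suc2 mult.assoc del: power_Suc)
  finally show ?case .
qed simp

lemma y_pow_e: "1 \<le> j \<Longrightarrow> j + k \<le> n \<Longrightarrow> y ^ k * e j = e (j + k) * y ^ k"
proof (induction k)
  case (Suc k)
  then show ?case
    using y_e[of "j + k", THEN mult_assoc_rule] by (simp add: mult.assoc)
qed simp

text \<open>The image of \<open>x ^ k\<close> starts at \<open>k + 1\<close>, so \<open>e j\<close>
  removes nothing. Algebraically, it is carried left until it is \<open>e 1\<close> right after an
  \<open>x\<close>, where \<open>x_e_1\<close> deletes it. The next three lemmas are the analogues
  for the domain of \<open>x ^ k\<close> and for powers of \<open>y\<close>.\<close>

lemma x_pow_e_absorb:
  assumes "1 \<le> j" "j \<le> k" "j \<le> n"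
  shows "x ^ k * e j = x ^ k"
proof -
  obtain i where i: "j = Suc i"
    using assms(1) by (cases j) auto
  have "x ^ j * e j = x * (e 1 * x ^ i)"
    using x_pow_e[of 1 i] assms i by (simp add: mult.assoc plus_1_eq_Suc)
  also have "\<dots> = x ^ j"
    using i by (simp add: x_e_1 flip: mult.assoc)
  finally have "x ^ (k - j) * x ^ j * e j = x ^ (k - j) * x ^ j"
    by (simp add: mult.assoc)
  then show ?thesis
    using assms by (simp flip: power_add)
qed

lemma e_x_pow_absorb:
  assumes "j \<in> {1..n}" "n < j + k"
  shows "e j * x ^ k = x ^ k"
proof -
  define i where "i = n - j"
  have "e j * x ^ i = x ^ i * e n"
    using x_pow_e[of j i] assms(1) by (simp add: i_def)
  then have "e j * x ^ i * x = x ^ i * x"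
    by (simp add: e_n_x mult.assoc)
  then have "e j * (x ^ Suc i * x ^ (k - Suc i)) = x ^ Suc i * x ^ (k - Suc i)"
    by (simp add: power_Suc2 del: power_Suc flip: mult.assoc)
  moreover have "k = Suc i + (k - Suc i)"
    using assms by (simp add: i_def)
  ultimately show ?thesis
    by (metis power_add)
qed

lemma y_pow_e_absorb:
  assumes "j \<in> {1..n}" "n < j + k"
  shows "y ^ k * e j = y ^ k"
proof -
  define i where "i = n - j"
  have "y * (y ^ i * e j) = y * y ^ i"
    using y_pow_e[of j i] y_e_n assms(1) by (simp add: i_def flip: mult.assoc)
  then have "y ^ (k - Suc i) * y ^ Suc i * e j = y ^ (k - Suc i) * y ^ Suc i"
    by (simp add: mult.assoc)
  moreover have "k = (k - Suc i) + Suc i"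
    using assms by (simp add: i_def)
  ultimately show ?thesis
    by (metis power_add)
qed

lemma e_y_pow_absorb:
  assumes "1 \<le> j" "j \<le> k" "j \<le> n"
  shows "e j * y ^ k = y ^ k"
proof -
  obtain i where i: "j = Suc i"
    using assms(1) by (cases j) auto
  have "e j * y ^ j = e j * y ^ i * y"
    by (simp add: i power_Suc2 mult.assoc del: power_Suc)
  also have "\<dots> = y ^ i * e 1 * y"
    using y_pow_e[of 1 i] assms i by (simp add: plus_1_eq_Suc)
  also have "\<dots> = y ^ j"
    by (simp add: e_1_y i power_Suc2 mult.assoc del: power_Suc)
  finally have "e j * (y ^ j * y ^ (k - j)) = y ^ j * y ^ (k - j)"
    by (simp flip: mult.assoc)
  then show ?thesis
    using assms by (simp flip: power_add)
qed

section \<open>The zero element, which represents the empty map\<close>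

definition z :: 'a where "z = P [1..<Suc n]"

lemma P_full: "set l = {1..n} \<Longrightarrow> P l = z"
  unfolding z_def by (rule P_cong) (simp_all add: atLeastLessThanSuc_atLeastAtMost del: upt_Suc)

text \<open>With \<open>xy\<close> read as \<open>e n\<close>, (V8) equates \<open>e 1\<close> and
  \<open>x\<close> in front of the product of all \<open>e j\<close> with \<open>2 \<le> j\<close>,
  and the first of these is \<open>z\<close>. As maps: no point in the image of \<open>x\<close>
  survives.\<close>

lemma x_tail: "x * P [2..<Suc n] = z" and e_1_tail: "e 1 * P [2..<Suc n] = z"
proof -
  have "[2..<Suc n] = [2..<n] @ [n]"
    using n4 by simp
  then have split: "P [2..<Suc n] = P [2..<n] * e n"
    by (simp only: P_append P_Cons P_Nil mult_1_right)
  have Es: "ev (Es 2 (n - 1)) = P [2..<n]"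
    using ev_Es[of 2 "n - 1"] n4 by simp
  have "([Y, X] @ Es 2 (n - 1) @ [X, Y], [X] @ Es 2 (n - 1) @ [X, Y]) \<in> relations n"
    by (auto simp: relations_def V8_def chain_def)
  from ev_rel[OF this]
  have "e 1 * P [2..<Suc n] = x * P [2..<Suc n]"
    unfolding split e_1 e_n by (simp only: ev_simps Es ev_Nil mult_1_right)
  moreover show "e 1 * P [2..<Suc n] = z"
  proof -
    have "{1..n} = insert 1 {2..<Suc n}"
      using n4 by force
    then show ?thesis
      using P_full[of "1 # [2..<Suc n]"] by (simp add: P_Cons del: upt_Suc)
  qed
  ultimately show "x * P [2..<Suc n] = z"
    by simp
qed

text \<open>The factor \<open>e n\<close> is absorbed by \<open>x\<close>; carrying \<open>x\<close>
  to the left raises the remaining indices by one, which leaves the product of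
  \<open>x_tail\<close>.\<close>

lemma z_x: "z * x = z"
proof -
  have "[1..<Suc n] = [1..<n] @ [n]"
    using n4 by simp
  then have "z * x = P [1..<n] * (e n * x)"
    by (simp add: z_def P_append P_Cons mult.assoc del: upt_Suc)
  also have "\<dots> = x * P (map Suc [1..<n])"
    using P_x[of "[1..<n]"] by (simp add: e_n_x)
  also have "map Suc [1..<n] = [2..<Suc n]"
    by (simp add: map_Suc_upt Suc_1 del: upt_Suc)
  finally show ?thesis
    by (simp only: x_tail)
qed

text \<open>The factor \<open>e 1\<close> is absorbed by \<open>y\<close>, and carrying
  \<open>y\<close> to the left lowers the remaining indices, so that only \<open>e n\<close> is
  missing; \<open>y_e_n\<close> supplies it. This gives \<open>y * z\<close>, and writing
  \<open>z\<close> as in \<open>x_tail\<close> turns the front into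
  \<open>y * x = e 1\<close>.\<close>

lemma z_y: "z * y = z"
proof -
  have shift: "map Suc [1..<n] = [2..<Suc n]"
    by (simp add: map_Suc_upt Suc_1 del: upt_Suc)
  have "z = P [2..<Suc n] * e 1"
    using n4 P_e_comm[of "[2..<Suc n]" 1] by (simp add: e_1_tail subset_eq del: upt_Suc)
  then have "z * y = P [2..<Suc n] * y"
    by (simp only: mult.assoc e_1_y)
  also have "\<dots> = y * P [1..<n]"
    using y_P[of "[1..<n]"] by (simp only: shift set_upt)
  also have "\<dots> = y * P (n # [1..<n])"
    using y_e_n[THEN mult_assoc_rule] by (simp only: P_Cons)
  also have "P (n # [1..<n]) = z"
    using n4 by (intro P_full) (simp add: atLeastLessThanSuc_atLeastAtMost[symmetric]
      atLeastLessThanSuc)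
  also have "y * z = e 1 * P [2..<Suc n]"
    by (simp only: x_tail[symmetric] e_1 mult.assoc)
  also have "\<dots> = z"
    by (rule e_1_tail)
  finally show ?thesis .
qed

lemma z_x_pow: "z * x ^ k = z" and z_y_pow: "z * y ^ k = z"
  by (induction k) (simp_all add: z_x[THEN mult_assoc_rule] z_y[THEN mult_assoc_rule])

section \<open>When two translations have the same value\<close>

lemma up_normal: "P l * x ^ k = P (l @ [Suc (n - k)..<Suc n]) * x ^ k"
proof -
  have "P [Suc (n - k)..<Suc n] * x ^ k = x ^ k"
    by (rule P_fix, rule e_x_pow_absorb) auto
  then show ?thesis
    by (simp add: P_append mult.assoc del: upt_Suc)
qed

lemma down_normal: "P l * y ^ k = P (l @ [1..<Suc (min k n)]) * y ^ k"
proof -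
  have "P [1..<Suc (min k n)] * y ^ k = y ^ k"
    by (rule P_fix, rule e_y_pow_absorb) auto
  then show ?thesis
    by (simp add: P_append mult.assoc del: upt_Suc)
qed

text \<open>Only indices in the domain \<open>{1..n - k}\<close> of \<open>x ^ k\<close> matter:
  \<open>up_normal\<close> adjoins all other indices to both lists, after which the two sets
  agree.\<close>

lemma up_eq:
  assumes "set l \<subseteq> {1..n}" "set l' \<subseteq> {1..n}"
    and "\<And>i. 1 \<le> i \<Longrightarrow> i + k \<le> n \<Longrightarrow> i \<in> set l \<longleftrightarrow> i \<in> set l'"
  shows "P l * x ^ k = P l' * x ^ k"
proof -
  have "P (l @ [Suc (n - k)..<Suc n]) = P (l' @ [Suc (n - k)..<Suc n])"
  proof (rule P_cong)
    have "i \<in> set l \<longleftrightarrow> i \<in> set l'" if "\<not> (Suc (n - k) \<le> i \<and> i < Suc n)" for i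
      using that assms by (cases "1 \<le> i \<and> i \<le> n") (fastforce simp: not_le)+
    then show "set (l @ [Suc (n - k)..<Suc n]) = set (l' @ [Suc (n - k)..<Suc n])"
      by (auto simp del: upt_Suc)
  qed (use assms in auto)
  then show ?thesis
    using up_normal by metis
qed

lemma down_eq:
  assumes "set l \<subseteq> {1..n}" "set l' \<subseteq> {1..n}"
    and "\<And>i. k < i \<Longrightarrow> i \<le> n \<Longrightarrow> i \<in> set l \<longleftrightarrow> i \<in> set l'"
  shows "P l * y ^ k = P l' * y ^ k"
proof -
  have "P (l @ [1..<Suc (min k n)]) = P (l' @ [1..<Suc (min k n)])"
  proof (rule P_cong)
    have "i \<in> set l \<longleftrightarrow> i \<in> set l'" if "\<not> (1 \<le> i \<and> i < Suc (min k n))" for i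
      using that assms by (cases "1 \<le> i \<and> i \<le> n") (fastforce simp: not_le)+
    then show "set (l @ [1..<Suc (min k n)]) = set (l' @ [1..<Suc (min k n)])"
      by (auto simp del: upt_Suc)
  qed (use assms in auto)
  then show ?thesis
    using down_normal by metis
qed

lemma up_zero:
  assumes "set l \<subseteq> {1..n}" "\<And>i. 1 \<le> i \<Longrightarrow> i + k \<le> n \<Longrightarrow> i \<in> set l"
  shows "P l * x ^ k = z"
proof -
  have "P l * x ^ k = P [1..<Suc n] * x ^ k"
    by (rule up_eq) (use assms in auto)
  then show ?thesis
    by (simp only: z_def[symmetric] z_x_pow)
qed

lemma down_zero:
  assumes "set l \<subseteq> {1..n}" "\<And>i. k < i \<Longrightarrow> i \<le> n \<Longrightarrow> i \<in> set l"
  shows "P l * y ^ k = z"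
proof -
  have "P l * y ^ k = P [1..<Suc n] * y ^ k"
    by (rule down_eq) (use assms in auto)
  then show ?thesis
    by (simp only: z_def[symmetric] z_y_pow)
qed


section \<open>Products of translations are translations\<close>

definition T :: "'a set" where "T = ev ` trans_words n"
definition F :: "'a set" where "F = ev ` flip_words n"

lemma T_iff: "t \<in> T \<longleftrightarrow> (\<exists>l k. set l \<subseteq> {1..n} \<and> (t = P l * x ^ k \<or> t = P l * y ^ k))"
  unfolding T_def trans_words_def ev_up_word[symmetric] ev_down_word[symmetric] by blast

lemma F_iff: "t \<in> F \<longleftrightarrow> (\<exists>a d c. 1 \<le> d \<and> 2 * d \<noteq> n \<and> a + d < n \<and> c < d \<and> t = y ^ a * f d * x ^ c)"
  unfolding F_def flip_words_def ev_flip_word[symmetric] by blast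

lemma T_up: "set l \<subseteq> {1..n} \<Longrightarrow> P l * x ^ k \<in> T"
  and T_down: "set l \<subseteq> {1..n} \<Longrightarrow> P l * y ^ k \<in> T"
  unfolding T_iff by blast+

lemma F_I: "1 \<le> d \<Longrightarrow> 2 * d \<noteq> n \<Longrightarrow> a + d < n \<Longrightarrow> c < d \<Longrightarrow> y ^ a * f d * x ^ c \<in> F"
  unfolding F_iff by blast

lemma x_pow_T: "x ^ k \<in> T" and y_pow_T: "y ^ k \<in> T" and one_T: "1 \<in> T"
  using T_up[of "[]"] T_down[of "[]"] T_up[of "[]" 0] by simp_all

text \<open>Exponent 0 of \<open>y\<close> is filed under \<open>x\<close>, so that the second case
  always has a factor \<open>y\<close> to split off.\<close>

lemma T_cases:
  assumes "t \<in> T"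
  obtains l k where "set l \<subseteq> {1..n}" "t = P l * x ^ k"
  | l k where "set l \<subseteq> {1..n}" "t = P l * y ^ Suc k"
proof -
  obtain l k where lk: "set l \<subseteq> {1..n}" "t = P l * x ^ k \<or> t = P l * y ^ k"
    using assms by (auto simp: T_iff)
  show ?thesis
    using lk that(1)[of l k] that(1)[of l 0] that(2)[of l] by (cases k) auto
qed

lemma T_e:
  assumes "t \<in> T" "j \<in> {1..n}"
  shows "t * e j \<in> T"
  using assms(1)
proof (cases rule: T_cases)
  case (1 l k)
  have "x ^ k * e j = x ^ k \<or> (\<exists>i\<in>{1..n}. x ^ k * e j = e i * x ^ k)"
  proof (cases "j \<le> k")
    case False
    then have "x ^ k * e j = e (j - k) * x ^ k"
      using x_pow_e[of "j - k" k] assms(2) by simp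
    then show ?thesis
      using False assms(2) by fastforce
  qed (use x_pow_e_absorb[of j k] assms(2) in simp)
  then show ?thesis
    using 1 T_up[of l k] T_up[of "l @ [_]" k] by (auto simp: mult.assoc P_append P_Cons)
next
  case (2 l k)
  have "y ^ Suc k * e j = y ^ Suc k \<or> (\<exists>i\<in>{1..n}. y ^ Suc k * e j = e i * y ^ Suc k)"
    using y_pow_e[of j "Suc k"] y_pow_e_absorb[of j "Suc k"] assms(2)
    by (cases "j + Suc k \<le> n") (fastforce simp del: power_Suc)+
  then show ?thesis
    using 2 T_down[of l "Suc k"] T_down[of "l @ [_]" "Suc k"]
    by (auto simp: mult.assoc P_append P_Cons simp del: power_Suc)
qed

lemma T_x:
  assumes "t \<in> T"
  shows "t * x \<in> T"
  using assms
proof (cases rule: T_cases)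
  case (1 l k)
  then show ?thesis
    using T_up[of l "Suc k"] by (simp add: mult.assoc power_commutes)
next
  case (2 l k)
  then have "t * x = P l * y ^ k * e 1"
    by (simp add: e_1 power_Suc2 mult.assoc del: power_Suc)
  then show ?thesis
    using T_e[OF T_down[OF 2(1), of k], of 1] n4 by simp
qed

lemma T_y:
  assumes "t \<in> T"
  shows "t * y \<in> T"
  using assms
proof (cases rule: T_cases)
  case (1 l k)
  show ?thesis
  proof (cases k)
    case 0
    then show ?thesis
      using 1 T_down[of l 1] by simp
  next
    case (Suc i)
    then have "t * y = P l * x ^ i * e n"
      using 1 by (simp add: e_n power_Suc2 mult.assoc del: power_Suc)
    then show ?thesis
      using T_e[OF T_up[OF 1(1), of i], of n] n4 by simp
  qed
next
  case (2 l k)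
  then show ?thesis
    using T_down[of l "Suc (Suc k)"] by (simp add: mult.assoc power_commutes)
qed

text \<open>Stated for an arbitrary set because it serves twice, for \<open>T\<close> and for the
  set \<open>N\<close> of values of all normal forms.\<close>

lemma mult_T_closed:
  assumes "\<And>s. s \<in> S \<Longrightarrow> s * x \<in> S" "\<And>s. s \<in> S \<Longrightarrow> s * y \<in> S"
    and "\<And>s j. s \<in> S \<Longrightarrow> j \<in> {1..n} \<Longrightarrow> s * e j \<in> S"
    and "s \<in> S" "t \<in> T"
  shows "s * t \<in> S"
proof -
  have pow: "s * x ^ k \<in> S" "s * y ^ k \<in> S" if "s \<in> S" for s k
    by (induction k)
       (use assms(1,2) that in \<open>simp_all add: power_Suc2 mult.assoc[symmetric] del: power_Suc\<close>)
  have "s * P l \<in> S" if "s \<in> S" "set l \<subseteq> {1..n}" for s l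
    using that by (induction l arbitrary: s) (simp_all add: P_Cons assms(3) mult.assoc[symmetric])
  then show ?thesis
    using pow assms(4,5) by (auto simp: T_iff mult.assoc[symmetric])
qed

lemma T_T: "s \<in> T \<Longrightarrow> t \<in> T \<Longrightarrow> s * t \<in> T"
  by (rule mult_T_closed[of T]) (use T_x T_y T_e in blast)+

text \<open>This recognises the right-hand sides of (V9), (V13) and (V14) as translations without
  computing which ones they are.\<close>

lemma ev_T: "set w \<subseteq> {X, Y} \<union> E ` {2..n - 1} \<Longrightarrow> ev w \<in> T"
proof (induction w rule: rev_induct)
  case (snoc b w)
  then have w: "ev w \<in> T"
    by simp
  have "e j = \<phi> (E j)" "j \<in> {1..n}" if "j \<in> {2..n - 1}" for j
    using e_mid[OF that] that by auto
  then have "ev w * \<phi> (E j) \<in> T" if "j \<in> {2..n - 1}" for j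
    using T_e[OF w, of j] that by metis
  moreover have "b = X \<or> b = Y \<or> (\<exists>j\<in>{2..n - 1}. b = E j)"
    using snoc.prems by auto
  ultimately show ?case
    using T_x[OF w] T_y[OF w] unfolding x_def y_def ev_append ev_Cons ev_Nil mult_1_right by blast
qed (simp add: one_T)

lemma ev_chain: "chain ws \<subseteq> relations n \<Longrightarrow> u \<in> set ws \<Longrightarrow> ev u = ev (last ws)"
proof (induction ws arbitrary: u rule: induct_list012)
  case (3 a b ws)
  have "(a, b) \<in> relations n" "chain (b # ws) \<subseteq> relations n"
    using "3.prems"(1) by (auto simp: chain_def)
  then have "ev a = ev b" "ev v = ev (last (b # ws))" if "v \<in> set (b # ws)" for v
    using "3.IH"(2)[OF _ that] ev_rel by blast+
  then show ?case
    using "3.prems"(2) by (metis last_ConsR list.distinct(1) list.set_intros(1) set_ConsD)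
qed (simp_all add: chain_def)

section \<open>Flip letters: the relations (V9)-(V14) in a form uniform in \<open>d\<close>\<close>

lemma flip_cases:
  assumes "1 \<le> d" "d < n" "2 * d \<noteq> n"
  obtains "d = 1" "d \<in> {1..m_of n}" "f d = \<phi> (Xs 1)" "f (n - d) = \<phi> (Ys 1)"
  | "d \<in> {2..m_of n}" "f d = \<phi> (Xs d)" "f (n - d) = \<phi> (Ys d)"
  | "n - d = 1" "n - d \<in> {1..m_of n}" "f d = \<phi> (Ys 1)" "f (n - d) = \<phi> (Xs 1)"
  | i where "d = n - i" "i \<in> {2..m_of n}" "f d = \<phi> (Ys i)" "f (n - d) = \<phi> (Xs i)"
proof -
  have fd: "f d = \<phi> (flip_letter n d)" "f (n - d) = \<phi> (flip_letter n (n - d))"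
    by (simp_all add: f_def)
  show ?thesis
  proof (cases "2 * d < n")
    case True
    then have "flip_letter n d = Xs d" "flip_letter n (n - d) = Ys d"
      using assms by (auto simp: flip_letter_def)
    moreover have "d \<in> {1..m_of n}"
      using assms True by (simp add: m_of_def)
    \<comment> \<open>Index 1 is kept apart, as in the relations: there \<open>n - i + 1\<close> is
      \<open>n\<close>, whose idempotent is the word \<open>xy\<close> and not a letter.\<close>
    ultimately show ?thesis
      using that(1,2) fd by (cases "d = 1") auto
  next
    case False
    then have "flip_letter n d = Ys (n - d)" "flip_letter n (n - d) = Xs (n - d)"
      using assms by (auto simp: flip_letter_def)
    moreover have "n - d \<in> {1..m_of n}"
      using assms False by (auto simp: m_of_def)
    ultimately show ?thesis
      using that(3) that(4)[of "n - d"] fd assms by (cases "n - d = 1") auto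
  qed
qed

lemma flip_chain:
  "i \<in> {1..m_of n} \<Longrightarrow> chain [[Xs i, Ys i], Es 2 i @ Es (i + 2) (n - 1) @ [X, Y]] \<subseteq> relations n"
  "chain [[Ys 1, Xs 1], Es 2 (n - 1)] \<subseteq> relations n"
  "i \<in> {2..m_of n} \<Longrightarrow>
    chain [[Ys i, Xs i], Es 2 (n - i) @ Es (n - i + 2) (n - 1) @ [X, Y]] \<subseteq> relations n"
proof -
  have "V9 n \<subseteq> relations n"
    unfolding relations_def by blast
  then show
    "i \<in> {1..m_of n} \<Longrightarrow> chain [[Xs i, Ys i], Es 2 i @ Es (i + 2) (n - 1) @ [X, Y]] \<subseteq> relations n"
    "chain [[Ys 1, Xs 1], Es 2 (n - 1)] \<subseteq> relations n"
    "i \<in> {2..m_of n} \<Longrightarrow>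
      chain [[Ys i, Xs i], Es 2 (n - i) @ Es (n - i + 2) (n - 1) @ [X, Y]] \<subseteq> relations n"
    unfolding V9_def by blast+
qed

text \<open>The two flips are inverse to each other, so their product is the identity on
  \<open>{1, d + 1}\<close>, spelled out by (V9).\<close>

lemma f_f:
  assumes "1 \<le> d" "d < n" "2 * d \<noteq> n"
  shows "f d * f (n - d) \<in> T"
  using assms
proof (cases rule: flip_cases)
  case 1
  with ev_chain[OF flip_chain(1)[of 1], of "[Xs 1, Ys 1]"] show ?thesis
    by (auto simp: ev_Cons Es_def intro!: ev_T)
next
  case 2
  then have "d \<in> {1..m_of n}"
    by simp
  with 2 ev_chain[OF flip_chain(1)[of d], of "[Xs d, Ys d]"] show ?thesis
    by (auto simp: ev_Cons Es_def m_of_def intro!: ev_T)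
next
  case 3
  with ev_chain[OF flip_chain(2), of "[Ys 1, Xs 1]"] show ?thesis
    by (auto simp: ev_Cons Es_def intro!: ev_T)
next
  case (4 i)
  with ev_chain[OF flip_chain(3)[of i], of "[Ys i, Xs i]"] show ?thesis
    by (auto simp: ev_Cons Es_def m_of_def intro!: ev_T)
qed


text \<open>The image \<open>{1, n - d + 1}\<close> of the flip misses \<open>j\<close>. For
  \<open>Xs\<close> this is (V10), for \<open>Ys\<close> it is (V11); the case \<open>j = n\<close>
  comes from (V12) and does not arise for \<open>Xs 1\<close>, whose image contains
  \<open>n\<close>.\<close>

lemma f_e:
  assumes "1 \<le> d" "d < n" "2 * d \<noteq> n" and j: "j \<in> {2..n}" "j \<noteq> n - d + 1"
  shows "f d * e j = f d"
proof -
  have V: "V10 n \<subseteq> relations n" "V11 n \<subseteq> relations n" "V12 n \<subseteq> relations n"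
    unfolding relations_def by blast+
  show ?thesis
    using assms(1-3)
  proof (cases rule: flip_cases)
    case 1
    then have mid: "j \<in> {2..n - 1} - {n - 1 + 1}"
      using j by auto
    then have "chain [[Xs 1, E j], [Xs 1]] \<subseteq> relations n"
      using V(1) 1 unfolding V10_def by blast
    from ev_chain[OF this, of "[Xs 1, E j]"] 1 mid show ?thesis
      by (simp add: ev_Cons e_mid)
  next
    case 2
    show ?thesis
    proof (cases "j = n")
      case True
      have "chain [[Xs d, X, Y], [X, Y, Xs d], [Xs d]] \<subseteq> relations n"
        using V(3) 2 unfolding V12_def by blast
      from ev_chain[OF this, of "[Xs d, X, Y]"] 2 True show ?thesis
        by (simp add: ev_Cons e_n x_def y_def)
    next
      case False
      then have mid: "j \<in> {2..n - 1} - {n - d + 1}" and d: "d \<in> {1..m_of n}"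
        using j 2 by auto
      then have "chain [[Xs d, E j], [Xs d]] \<subseteq> relations n"
        using V(1) unfolding V10_def by blast
      from ev_chain[OF this, of "[Xs d, E j]"] 2 mid show ?thesis
        by (simp add: ev_Cons e_mid)
    qed
  next
    case 3
    show ?thesis
    proof (cases "j = n")
      case True
      have "chain [[Ys 1, X, Y], [Ys 1]] \<subseteq> relations n"
        using V(3) unfolding V12_def by blast
      from ev_chain[OF this, of "[Ys 1, X, Y]"] 3 True show ?thesis
        by (simp add: ev_Cons e_n x_def y_def)
    next
      case False
      then have mid: "j \<in> {2..n - 1} - {1 + 1}" "1 \<in> {1..m_of n}"
        using j 3 by auto
      then have "chain [[Ys 1, E j], [Ys 1]] \<subseteq> relations n"
        using V(2) unfolding V11_def by blast
      from ev_chain[OF this, of "[Ys 1, E j]"] 3 mid show ?thesis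
        by (simp add: ev_Cons e_mid)
    qed
  next
    case (4 i)
    show ?thesis
    proof (cases "j = n")
      case True
      have "chain [[X, Y, Ys i], [Ys i, X, Y], [Ys i]] \<subseteq> relations n"
        using V(3) 4 unfolding V12_def by blast
      from ev_chain[OF this, of "[Ys i, X, Y]"] 4 True show ?thesis
        by (simp add: ev_Cons e_n x_def y_def)
    next
      case False
      then have mid: "j \<in> {2..n - 1} - {i + 1}" "i \<in> {1..m_of n}"
        using j 4 assms by auto
      then have "chain [[Ys i, E j], [Ys i]] \<subseteq> relations n"
        using V(2) unfolding V11_def by blast
      from ev_chain[OF this, of "[Ys i, E j]"] 4 mid show ?thesis
        by (simp add: ev_Cons e_mid)
    qed
  qed
qed

text \<open>Now the domain \<open>{1, d + 1}\<close> misses \<open>j\<close>. The roles of (V10) and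
  (V11) are exchanged, and it is \<open>Ys 1\<close> whose domain contains \<open>n\<close>.\<close>

lemma e_f:
  assumes "1 \<le> d" "d < n" "2 * d \<noteq> n" and j: "j \<in> {2..n}" "j \<noteq> d + 1"
  shows "e j * f d = f d"
proof -
  have V: "V10 n \<subseteq> relations n" "V11 n \<subseteq> relations n" "V12 n \<subseteq> relations n"
    unfolding relations_def by blast+
  show ?thesis
    using assms(1-3)
  proof (cases rule: flip_cases)
    case 1
    show ?thesis
    proof (cases "j = n")
      case True
      have "chain [[X, Y, Xs 1], [Xs 1]] \<subseteq> relations n"
        using V(3) unfolding V12_def by blast
      from ev_chain[OF this, of "[X, Y, Xs 1]"] 1 True show ?thesis
        by (simp add: ev_Cons e_n x_def y_def mult.assoc)
    next
      case False
      then have mid: "j \<in> {2..n - 1} - {1 + 1}" "1 \<in> {1..m_of n}"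
        using j 1 by auto
      then have "chain [[E j, Xs 1], [Xs 1]] \<subseteq> relations n"
        using V(2) unfolding V11_def by blast
      from ev_chain[OF this, of "[E j, Xs 1]"] 1 mid show ?thesis
        by (simp add: ev_Cons e_mid)
    qed
  next
    case 2
    show ?thesis
    proof (cases "j = n")
      case True
      have "chain [[Xs d, X, Y], [X, Y, Xs d], [Xs d]] \<subseteq> relations n"
        using V(3) 2 unfolding V12_def by blast
      from ev_chain[OF this, of "[X, Y, Xs d]"] 2 True show ?thesis
        by (simp add: ev_Cons e_n x_def y_def mult.assoc)
    next
      case False
      then have mid: "j \<in> {2..n - 1} - {d + 1}" and d: "d \<in> {1..m_of n}"
        using j 2 by auto
      then have "chain [[E j, Xs d], [Xs d]] \<subseteq> relations n"
        using V(2) unfolding V11_def by blast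
      from ev_chain[OF this, of "[E j, Xs d]"] 2 mid show ?thesis
        by (simp add: ev_Cons e_mid)
    qed
  next
    case 3
    then have mid: "j \<in> {2..n - 1} - {n - 1 + 1}" "1 \<in> {1..m_of n}"
      using j assms by auto
    then have "chain [[E j, Ys 1], [Ys 1]] \<subseteq> relations n"
      using V(1) unfolding V10_def by blast
    from ev_chain[OF this, of "[E j, Ys 1]"] 3 mid show ?thesis
      by (simp add: ev_Cons e_mid)
  next
    case (4 i)
    show ?thesis
    proof (cases "j = n")
      case True
      have "chain [[X, Y, Ys i], [Ys i, X, Y], [Ys i]] \<subseteq> relations n"
        using V(3) 4 unfolding V12_def by blast
      from ev_chain[OF this, of "[X, Y, Ys i]"] 4 True show ?thesis
        by (simp add: ev_Cons e_n x_def y_def mult.assoc)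
    next
      case False
      then have mid: "j \<in> {2..n - 1} - {n - i + 1}" "i \<in> {1..m_of n}"
        using j 4 by auto
      then have "chain [[E j, Ys i], [Ys i]] \<subseteq> relations n"
        using V(1) unfolding V10_def by blast
      from ev_chain[OF this, of "[E j, Ys i]"] 4 mid show ?thesis
        by (simp add: ev_Cons e_mid)
    qed
  qed
qed

text \<open>Either idempotent removes the pair of \<open>d + 1\<close> and \<open>n - d + 1\<close>
  and leaves 1 fixed, so all these products are the common right-hand side of (V14).\<close>

lemma flip_end:
  assumes "1 \<le> d" "d < n" "2 * d \<noteq> n"
  shows "f d * e (n - d + 1) \<in> T" and "e (d + 1) * f d \<in> T"
proof -
  have V: "V14 n \<subseteq> relations n"
    unfolding relations_def by blast
  let ?w = "Es 2 (n - 1) @ [X, Y]"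
  have w: "ev ?w \<in> T"
    by (rule ev_T) (auto simp: Es_def)
  have c1: "chain [[Xs 1, X, Y], [E 2, Xs 1], [Ys 1, E 2], [X, Y, Ys 1], ?w] \<subseteq> relations n"
    using V unfolding V14_def by blast
  have c: "chain [[Xs i, E (n - i + 1)], [E (i + 1), Xs i], [Ys i, E (i + 1)],
      [E (n - i + 1), Ys i], ?w] \<subseteq> relations n" if "i \<in> {2..m_of n}" for i
    using V that unfolding V14_def by blast
  have e2: "e (1 + 1) = \<phi> (E 2)"
    using e_mid[of 2] n4 by (simp add: Suc_1)
  have ei: "e (i + 1) = \<phi> (E (i + 1))" "e (n - i + 1) = \<phi> (E (n - i + 1))" if "i \<in> {2..m_of n}" for i
    using that n4 by (auto simp: m_of_def intro!: e_mid)
  have "f d * e (n - d + 1) = ev ?w \<and> e (d + 1) * f d = ev ?w"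
    using assms
  proof (cases rule: flip_cases)
    case 1
    then show ?thesis
      using ev_chain[OF c1, of "[Xs 1, X, Y]"] ev_chain[OF c1, of "[E 2, Xs 1]"] e2 n4
      by (simp add: ev_Cons e_n x_def y_def)
  next
    case 2
    then show ?thesis
      using ev_chain[OF c[of d], of "[Xs d, E (n - d + 1)]"] ei[of d]
        ev_chain[OF c[of d], of "[E (d + 1), Xs d]"]
      by (simp add: ev_Cons)
  next
    case 3
    moreover have "d + 1 = n"
      using 3 assms by simp
    ultimately show ?thesis
      using ev_chain[OF c1, of "[Ys 1, E 2]"] ev_chain[OF c1, of "[X, Y, Ys 1]"] e2 n4 assms
      by (simp add: ev_Cons e_n x_def y_def mult.assoc)
  next
    case (4 i)
    moreover have "n - d = i"
      using 4 assms by auto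
    ultimately show ?thesis
      using ev_chain[OF c[of i], of "[Ys i, E (i + 1)]"] ei[of i]
        ev_chain[OF c[of i], of "[E (n - i + 1), Ys i]"]
      by (simp add: ev_Cons)
  qed
  then show "f d * e (n - d + 1) \<in> T" "e (d + 1) * f d \<in> T"
    using w by simp_all
qed

text \<open>Here the fixed point 1 is removed. What remains sends \<open>d + 1\<close> to
  \<open>n - d + 1\<close>; as a map on one point it is a translation, and the last words of the
  chains in (V13) spell it out.\<close>

lemma flip_e_1:
  assumes "1 \<le> d" "d < n" "2 * d \<noteq> n"
  shows "f d * e 1 \<in> T" and "e 1 * f d \<in> T"
proof -
  have V: "V13 n \<subseteq> relations n"
    unfolding relations_def by blast
  have T: "f d * e 1 \<in> T \<and> e 1 * f d \<in> T"
    if "f d = \<phi> b" "chain [[Y, X, b], [b, Y, X], w] \<subseteq> relations n"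
      and "set w \<subseteq> {X, Y} \<union> E ` {2..n - 1}" for b w
    using ev_chain[OF that(2), of "[Y, X, b]"] ev_chain[OF that(2), of "[b, Y, X]"] ev_T[OF that(3)]
    by (simp add: ev_Cons that(1) e_1 x_def y_def mult.assoc)
  have Es: "set (Es a b) \<subseteq> {X, Y} \<union> E ` {2..n - 1}" if "2 \<le> a" "b \<le> n - 1" for a b
    unfolding set_Es using that by (intro le_supI2 image_mono) auto
  have Ys: "chain [[Y, X, Ys i], [Ys i, Y, X],
      replicate (n - 2 * i + 1) Y @ [X] @ Es 2 i @ Es (i + 2) (2 * i)] \<subseteq> relations n"
    if "i \<in> {1..m_of n}" for i
    using V that unfolding V13_def by blast
  have rep: "set (replicate k b) \<subseteq> {X, Y} \<union> A" if "b \<in> {X, Y}" for k b A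
    using that by (induction k) auto
  have m: "2 * i < n" if "i \<in> {1..m_of n}" for i
    using that by (auto simp: m_of_def)
  have "f d * e 1 \<in> T \<and> e 1 * f d \<in> T"
    using assms
  proof (cases rule: flip_cases)
    case 1
    have "chain [[Y, X, Xs 1], [Xs 1, Y, X], replicate (n - 2) X @ [E (n - 1)]] \<subseteq> relations n"
      using V unfolding V13_def by blast
    then show ?thesis
    proof (rule T[OF 1(3)])
      have "n - 1 \<in> {2..n - 1}"
        using n4 by simp
      then show "set (replicate (n - 2) X @ [E (n - 1)]) \<subseteq> {X, Y} \<union> E ` {2..n - 1}"
        unfolding set_append by (intro Un_least rep) simp_all
    qed
  next
    case 2
    have "chain [[Y, X, Xs d], [Xs d, Y, X], replicate (n - 2 * d) X @
        Es (n - 2 * d + 1) (n - d) @ Es (n - d + 2) (n - 1) @ [X, Y]] \<subseteq> relations n"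
      using V 2 unfolding V13_def by blast
    then show ?thesis
    proof (rule T[OF 2(2)])
      have "set (Es (n - 2 * d + 1) (n - d)) \<subseteq> {X, Y} \<union> E ` {2..n - 1}"
        "set (Es (n - d + 2) (n - 1)) \<subseteq> {X, Y} \<union> E ` {2..n - 1}"
      proof -
        have "2 \<le> d" "2 * d < n"
          using 2(1) m[of d] by simp_all
        then show "set (Es (n - 2 * d + 1) (n - d)) \<subseteq> {X, Y} \<union> E ` {2..n - 1}"
          "set (Es (n - d + 2) (n - 1)) \<subseteq> {X, Y} \<union> E ` {2..n - 1}"
          by (intro Es; linarith)+
      qed
      then show "set (replicate (n - 2 * d) X @ Es (n - 2 * d + 1) (n - d) @
          Es (n - d + 2) (n - 1) @ [X, Y]) \<subseteq> {X, Y} \<union> E ` {2..n - 1}"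
        unfolding set_append by (intro Un_least rep) simp_all
    qed
  next
    case 3
    have "1 \<in> {1..m_of n}"
      using 3(1,2) by simp
    then show ?thesis
    proof (rule T[OF 3(3) Ys])
      show "set (replicate (n - 2 * 1 + 1) Y @ [X] @ Es 2 1 @ Es (1 + 2) (2 * 1))
          \<subseteq> {X, Y} \<union> E ` {2..n - 1}"
        unfolding set_append by (intro Un_least rep) (simp_all only: Es_trivial list.set, auto)
    qed
  next
    case (4 i)
    then have i: "i \<in> {1..m_of n}"
      by simp
    from Ys[OF this] show ?thesis
    proof (rule T[OF 4(3)])
      have "set (Es 2 i) \<subseteq> {X, Y} \<union> E ` {2..n - 1}"
        "set (Es (i + 2) (2 * i)) \<subseteq> {X, Y} \<union> E ` {2..n - 1}"
        using m[OF i] by (intro Es; simp)+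
      then show "set (replicate (n - 2 * i + 1) Y @ [X] @ Es 2 i @ Es (i + 2) (2 * i))
          \<subseteq> {X, Y} \<union> E ` {2..n - 1}"
        unfolding set_append by (intro Un_least rep) simp_all
    qed
  qed
  then show "f d * e 1 \<in> T" "e 1 * f d \<in> T"
    by simp_all
qed

lemma e_T: "t \<in> T \<Longrightarrow> j \<in> {1..n} \<Longrightarrow> e j * t \<in> T"
  using T_T[OF T_e[OF one_T]] by simp

section \<open>Closure of the normal forms under right multiplication\<close>

definition N :: "'a set" where "N = T \<union> F"

lemma N_x:
  assumes "s \<in> N"
  shows "s * x \<in> N"
proof (cases "s \<in> T")
  case False
  then obtain a d c where d: "1 \<le> d" "2 * d \<noteq> n" "a + d < n" "c < d"
    and s: "s = y ^ a * f d * x ^ c"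
    using assms by (auto simp: N_def F_iff)
  have sx: "s * x = y ^ a * f d * x ^ Suc c"
    by (simp add: s power_Suc2 mult.assoc del: power_Suc)
  show ?thesis
  proof (cases "Suc c < d")
    case True
    then show ?thesis
      unfolding sx N_def using d by (intro UnI2 F_I)
  next
    case False
    \<comment> \<open>Now \<open>c + 1 = d\<close>, so \<open>a + d + 1\<close> had image
      \<open>n\<close> and is lost under one more \<open>x\<close>; accordingly
      \<open>x ^ Suc c\<close> contains a hidden \<open>e (n - d + 1)\<close>, which meets the flip
      letter.\<close>
    then have "x ^ Suc c = e (n - d + 1) * x ^ Suc c"
      using d by (intro e_x_pow_absorb[symmetric]) auto
    then have "s * x = y ^ a * (f d * e (n - d + 1)) * x ^ Suc c"
      using sx by (simp only: mult.assoc)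
    also have "\<dots> \<in> T"
      using d by (intro T_T y_pow_T x_pow_T flip_end) auto
    finally show ?thesis
      by (simp add: N_def)
  qed
qed (simp add: N_def T_x)

lemma N_e:
  assumes "s \<in> N" and j: "j \<in> {1..n}"
  shows "s * e j \<in> N"
proof (cases "s \<in> T")
  case False
  then obtain a d c where d: "1 \<le> d" "2 * d \<noteq> n" "a + d < n" "c < d"
    and s: "s = y ^ a * f d * x ^ c"
    using assms by (auto simp: N_def F_iff)
  show ?thesis
  proof (cases "j \<le> c")
    case True
    then show ?thesis
      using assms x_pow_e_absorb[of j c] by (simp add: s mult.assoc)
  next
    case False
    \<comment> \<open>\<open>e j\<close> passes \<open>x ^ c\<close> as \<open>e (j - c)\<close> and
      then meets the flip letter.\<close>
    define i where "i = j - c"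
    have i: "i \<in> {1..n}"
      using False j by (auto simp: i_def)
    have "x ^ c * e j = e i * x ^ c"
      using False j x_pow_e[of i c] by (simp add: i_def)
    then have se: "s * e j = y ^ a * (f d * e i) * x ^ c"
      by (simp add: s mult.assoc)
    have "f d * e i \<in> T \<or> f d * e i = f d"
      using d i flip_e_1(1)[of d] flip_end(1)[of d] f_e[of d i]
      by (cases "i = 1"; cases "i = n - d + 1") auto
    then show ?thesis
    proof
      assume "f d * e i \<in> T"
      then show ?thesis
        unfolding se N_def by (simp add: T_T y_pow_T x_pow_T)
    next
      assume "f d * e i = f d"
      then show ?thesis
        using se s assms(1) by simp
    qed
  qed
qed (simp add: N_def T_e j[simplified])

lemma N_y:
  assumes "s \<in> N"
  shows "s * y \<in> N"
proof (cases "s \<in> T")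
  case False
  then obtain a d c where d: "1 \<le> d" "2 * d \<noteq> n" "a + d < n" "c < d"
    and s: "s = y ^ a * f d * x ^ c"
    using assms by (auto simp: N_def F_iff)
  show ?thesis
  proof (cases c)
    case 0
    \<comment> \<open>The point with image 1 is lost under \<open>y\<close>; the hidden factor is
      \<open>e 1\<close>.\<close>
    then have "s * y = y ^ a * (f d * e 1) * y"
      by (simp add: s mult.assoc e_1_y)
    also have "\<dots> \<in> T"
      using d by (intro T_T y_pow_T T_y flip_e_1) auto
    finally show ?thesis
      by (simp add: N_def)
  next
    case (Suc i)
    have "y ^ a * f d * x ^ i \<in> N"
      using d Suc F_I by (simp add: N_def)
    moreover have "s * y = y ^ a * f d * x ^ i * e n"
      by (simp add: s Suc e_n power_Suc2 mult.assoc del: power_Suc)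
    ultimately show ?thesis
      using N_e[of _ n] n4 by simp
  qed
qed (simp add: N_def T_y)

lemma N_T: "s \<in> N \<Longrightarrow> t \<in> T \<Longrightarrow> s * t \<in> N"
  by (rule mult_T_closed[of N]) (use N_x N_y N_e in blast)+

text \<open>Whenever the image of the left factor misses 1 or \<open>d + 1\<close>, that factor
  absorbs \<open>e 1\<close> or \<open>e (d + 1)\<close>, and this idempotent turns
  \<open>f d\<close> into a translation. Otherwise the product is computed:
  \<open>y ^ k * f d\<close> is a normal form, and two mutually inverse flips multiply into
  \<open>T\<close> by \<open>f_f\<close>.\<close>

lemma N_f:
  assumes "s \<in> N" and d: "1 \<le> d" "d < n" "2 * d \<noteq> n"
  shows "s * f d \<in> N"
proof (cases "s \<in> T")
  case True
  then show ?thesis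
  proof (cases rule: T_cases)
    case (1 l k)
    show ?thesis
    proof (cases k)
      case 0
      \<comment> \<open>Each \<open>e j\<close> is either absorbed by \<open>f d\<close> or takes
        the product into \<open>T\<close>, which further factors on the left cannot leave.\<close>
      have "P l * f d \<in> T \<or> P l * f d = f d"
        using 1(1)
      proof (induction l)
        case (Cons j l)
        then have j: "j \<in> {1..n}"
          by simp
        have "e j * f d \<in> T \<or> e j * f d = f d"
          using d j flip_e_1(2)[of d] flip_end(2)[of d] e_f[of d j]
          by (cases "j = 1"; cases "j = d + 1") auto
        then show ?case
          using Cons e_T[OF _ j, of "P l * f d"] by (auto simp: P_Cons mult.assoc)
      qed simp
      then show ?thesis
        using 1 0 F_I[of d 0 0] d by (auto simp: N_def)
    next
      case (Suc i)
      \<comment> \<open>The image of a positive power of \<open>x\<close> misses 1.\<close>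
      have "x ^ Suc i * f d = x ^ Suc i * (e 1 * f d)"
        using x_pow_e_absorb[of 1 "Suc i"] n4 by (simp add: mult.assoc[symmetric] del: power_Suc)
      then have "s * f d = P l * x ^ k * (e 1 * f d)"
        by (simp add: 1 Suc mult.assoc del: power_Suc)
      then show ?thesis
        using T_T[OF T_up[OF 1(1)] flip_e_1(2)[OF d]] by (simp add: N_def)
    qed
  next
    case (2 l i)
    define k where "k = Suc i"
    show ?thesis
    proof (cases "k + d < n")
      case True
      have yk: "y ^ k * f d \<in> F"
        using F_I[of d k 0] d True by simp
      \<comment> \<open>As for \<open>k = 0\<close>, except that each \<open>e j\<close> is first
        absorbed by \<open>y ^ k\<close> or carried through it.\<close>
      have "P l * (y ^ k * f d) \<in> T \<or> P l * (y ^ k * f d) = y ^ k * f d"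
        using 2(1)
      proof (induction l)
        case (Cons j l)
        then have j: "j \<in> {1..n}"
          by simp
        have "e j * (y ^ k * f d) \<in> T \<or> e j * (y ^ k * f d) = y ^ k * f d"
        proof (cases "j \<le> k")
          case True
          then have "e j * y ^ k = y ^ k"
            using j e_y_pow_absorb by simp
          then show ?thesis
            by (simp flip: mult.assoc)
        next
          case False
          then have "e j * y ^ k = y ^ k * e (j - k)"
            using j y_pow_e[of "j - k" k] by simp
          then have "e j * y ^ k * f d = y ^ k * e (j - k) * f d"
            by simp
          then have eq: "e j * (y ^ k * f d) = y ^ k * (e (j - k) * f d)"
            by (simp only: mult.assoc)
          have "e (j - k) * f d \<in> T \<or> e (j - k) * f d = f d"
          proof -
            have "j - k = 1 \<or> j - k \<in> {2..n}"
              using j False by auto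
            then show ?thesis
              using d flip_e_1(2)[of d] flip_end(2)[of d] e_f[of d "j - k"]
              by (cases "j - k = d + 1") auto
          qed
          then show ?thesis
            using T_T[OF y_pow_T] unfolding eq by auto
        qed
        then show ?case
          using Cons e_T[OF _ j, of "P l * (y ^ k * f d)"] by (auto simp: P_Cons mult.assoc)
      qed simp
      then show ?thesis
        using 2 yk by (auto simp: N_def k_def mult.assoc simp del: power_Suc)
    next
      case False
      \<comment> \<open>The image of \<open>y ^ k\<close> ends at \<open>n - k\<close>, below
        \<open>d + 1\<close>.\<close>
      have "y ^ k * e (d + 1) = y ^ k"
        using False d by (intro y_pow_e_absorb) auto
      then have "s * f d = P l * y ^ k * (e (d + 1) * f d)"
        using mult_assoc_rule[of "y ^ k" "e (d + 1)" "y ^ k" "f d"] 2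
        by (simp add: k_def mult.assoc del: power_Suc)
      then show ?thesis
        using T_T[OF T_down[OF 2(1)] flip_end(2)[OF d]] by (simp add: N_def)
    qed
  qed
next
  case False
  then obtain a d' c where d': "1 \<le> d'" "2 * d' \<noteq> n" "a + d' < n" "c < d'"
    and s: "s = y ^ a * f d' * x ^ c"
    using assms by (auto simp: N_def F_iff)
  show ?thesis
  proof (cases c)
    case 0
    show ?thesis
    proof (cases "d = n - d'")
      case True
      then have "f d' * f d \<in> T"
        using d' f_f[of d'] by simp
      then show ?thesis
        using T_T[OF y_pow_T] 0 by (simp add: s N_def mult.assoc)
    next
      case False
      \<comment> \<open>The image of \<open>f d'\<close> is \<open>{1, n - d' + 1}\<close> and
        misses \<open>d + 1\<close>.\<close>
      have "f d' * e (d + 1) = f d'"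
        using d d' False by (intro f_e) auto
      then have "s * f d = s * (e (d + 1) * f d)"
        using 0 mult_assoc_rule[of "f d'" "e (d + 1)" "f d'" "f d"] by (simp add: s mult.assoc)
      then show ?thesis
        using N_T[OF assms(1) flip_end(2)[OF d]] by simp
    qed
  next
    case (Suc i)
    have "x ^ c * f d = x ^ c * (e 1 * f d)"
      using x_pow_e_absorb[of 1 c] Suc n4 by (simp add: mult.assoc[symmetric] del: power_Suc)
    then have "s * f d = s * (e 1 * f d)"
      by (simp add: s mult.assoc)
    then show ?thesis
      using N_T[OF assms(1) flip_e_1(2)[OF d]] by simp
  qed
qed

lemma ev_N: "w \<in> lists (alphabet n) \<Longrightarrow> ev w \<in> N"
proof (induction w rule: rev_induct)
  case (snoc b w)
  then have w: "ev w \<in> N" and b: "b \<in> alphabet n"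
    by auto
  have Es: "ev w * \<phi> (E j) \<in> N" if "j \<in> {2..n - 1}" for j
    using N_e[OF w, of j] e_mid[OF that] that by auto
  have Xs: "ev w * \<phi> (Xs i) \<in> N" if "i \<in> {1..m_of n}" for i
  proof -
    have i: "1 \<le> i" "2 * i < n"
      using that by (auto simp: m_of_def)
    then show ?thesis
      using N_f[OF w, of i] by (simp add: f_def flip_letter_def)
  qed
  have Ys: "ev w * \<phi> (Ys i) \<in> N" if "i \<in> {1..m_of n}" for i
  proof -
    have i: "1 \<le> i" "2 * i < n"
      using that by (auto simp: m_of_def)
    then have "\<not> 2 * (n - i) < n" "2 * (n - i) \<noteq> n" "n - (n - i) = i" "1 \<le> n - i" "n - i < n"
      by linarith+
    then show ?thesis
      using N_f[OF w, of "n - i"] by (simp add: f_def flip_letter_def)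
  qed
  show ?case
    using b N_x[OF w] N_y[OF w] Es Xs Ys
    unfolding ev_append ev_Cons ev_Nil mult_1_right x_def y_def alphabet_def by blast
qed (simp add: N_def one_T)

lemma normal_form:
  assumes "w \<in> lists (alphabet n)"
  obtains u where "u \<in> trans_words n \<union> flip_words n" "ev w = ev u"
  using ev_N[OF assms] unfolding N_def T_def F_def by blast

end

section \<open>The partial map represented by a word\<close>

text \<open>The guard on \<open>j\<close> for \<open>Xs\<close> and \<open>Ys\<close> keeps domain
  and image inside \<open>{1..n}\<close> even for letters outside the alphabet, so that
  \<open>val_range\<close> holds for every word.\<close>

definition letter_map :: "nat \<Rightarrow> letter \<Rightarrow> nat \<rightharpoonup> nat" where
  "letter_map n b i = (case b of
      X \<Rightarrow> if 1 \<le> i \<and> i < n then Some (i + 1) else None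
    | Y \<Rightarrow> if 2 \<le> i \<and> i \<le> n then Some (i - 1) else None
    | E j \<Rightarrow> if 1 \<le> i \<and> i \<le> n \<and> i \<noteq> j then Some i else None
    | Xs j \<Rightarrow> if 1 \<le> j \<and> j < n \<and> i \<in> {1, j + 1} then Some (if i = 1 then 1 else n - j + 1) else None
    | Ys j \<Rightarrow> if 1 \<le> j \<and> j < n \<and> i \<in> {1, n - j + 1} then Some (if i = 1 then 1 else j + 1) else None)"

primrec val :: "nat \<Rightarrow> letter list \<Rightarrow> nat \<rightharpoonup> nat" where
  "val n [] = (\<lambda>i. if i \<in> {1..n} then Some i else None)"
| "val n (b # w) = (\<lambda>i. Option.bind (letter_map n b i) (val n w))"

lemma bind_if_Some: "Option.bind (if P then Some a else None) g = (if P then g a else None)"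
  by simp

lemma letter_map_range: "letter_map n b i = Some k \<Longrightarrow> i \<in> {1..n} \<and> k \<in> {1..n}"
  by (auto simp: letter_map_def split: letter.splits if_splits)

lemma val_range: "val n w i = Some k \<Longrightarrow> i \<in> {1..n} \<and> k \<in> {1..n}"
  by (induction w arbitrary: i)
     (auto simp: bind_eq_Some_conv split: if_splits dest: letter_map_range)

lemma val_append: "val n (u @ v) i = Option.bind (val n u i) (val n v)"
proof (induction u arbitrary: i)
  case Nil
  then show ?case
    using val_range[of n v i] by (cases "val n v i") auto
next
  case (Cons b u)
  then show ?case
    by (cases "letter_map n b i") auto
qed

lemma val_Es: "val n (Es a b) i = (if i \<in> {1..n} \<and> \<not> (a \<le> i \<and> i \<le> b) then Some i else None)"
proof -
  have "val n (map E l) i = (if i \<in> {1..n} \<and> i \<notin> set l then Some i else None)" for l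
    by (induction l) (auto simp: letter_map_def)
  then show ?thesis
    by (auto simp: Es_def)
qed

lemma val_up: "val n (replicate k X) i = (if 1 \<le> i \<and> i + k \<le> n then Some (i + k) else None)"
  by (induction k arbitrary: i) (auto simp: letter_map_def)

lemma val_down: "val n (replicate k Y) i = (if k < i \<and> i \<le> n then Some (i - k) else None)"
  by (induction k arbitrary: i) (auto simp: letter_map_def)

lemma val_idem_words:
  "val n (concat (map (idem_word n) l)) i = (if i \<in> {1..n} \<and> i \<notin> set l then Some i else None)"
  by (induction l) (auto simp: letter_map_def val_append idem_word_def)

lemma val_up_word:
  "val n (up_word n l k) i = (if 1 \<le> i \<and> i + k \<le> n \<and> i \<notin> set l then Some (i + k) else None)"
  by (auto simp: up_word_def val_append val_idem_words val_up)

lemma val_down_word: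
  "val n (down_word n l k) i = (if k < i \<and> i \<le> n \<and> i \<notin> set l then Some (i - k) else None)"
  by (auto simp: down_word_def val_append val_idem_words val_down)

lemma val_flip_word:
  assumes "1 \<le> d" "a + d < n" "c < d"
  shows "val n (flip_word n a d c) = [a + 1 \<mapsto> c + 1, a + d + 1 \<mapsto> n - d + c + 1]"
  using assms
  by (auto simp: fun_eq_iff flip_word_def val_append val_up val_down flip_letter_def
      letter_map_def bind_if_Some)

section \<open>The relations hold for the represented maps\<close>

lemma val_chain:
  assumes "(u, v) \<in> chain ws" "\<forall>w\<in>set ws. val n w = g"
  shows "val n u = val n v"
proof -
  have "u \<in> set ws" "v \<in> set ws"
    using assms(1) by (auto simp: chain_def dest: set_zip_leftD set_zip_rightD intro: list.set_sel(2))
  then show ?thesis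
    using assms(2) by simp
qed

context
  fixes n :: nat
  assumes n4: "4 \<le> n"
begin

lemma le_m_of_iff: "i \<le> m_of n \<longleftrightarrow> 2 * i < n"
  using n4 by (auto simp: m_of_def)

lemmas val_simps = le_m_of_iff fun_eq_iff bind_if_Some letter_map_def val_append val_Es val_up val_down

lemma val_V1_to_V5: "(u, v) \<in> V1 n \<union> V2 \<union> V3 \<union> V4 n \<union> V5 n \<Longrightarrow> val n u = val n v"
  using n4 by (auto simp: V1_def V2_def V3_def V4_def V5_def chain_def val_simps)

lemma val_V6_V7: "(u, v) \<in> V6 n \<union> V7 n \<Longrightarrow> val n u = val n v"
  using n4 by (auto simp: V6_def V7_def chain_def val_simps)

lemma val_V8: "(u, v) \<in> V8 n \<Longrightarrow> val n u = val n v"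
  using n4 by (auto simp: V8_def chain_def val_simps)

lemma val_V9: "(u, v) \<in> V9 n \<Longrightarrow> val n u = val n v"
  using n4 by (auto simp: V9_def chain_def val_simps)

lemma val_V10: "(u, v) \<in> V10 n \<Longrightarrow> val n u = val n v"
  using n4 by (auto simp: V10_def chain_def val_simps)

lemma val_V11: "(u, v) \<in> V11 n \<Longrightarrow> val n u = val n v"
  using n4 by (auto simp: V11_def chain_def val_simps)

lemma val_V12: "(u, v) \<in> V12 n \<Longrightarrow> val n u = val n v"
  using n4 by (auto simp: V12_def chain_def val_simps)

text \<open>For (V13) the common value of each chain is given explicitly: the one-point map that is
  left of a flip when 1 is removed.\<close>

lemma val_V13_x1:
  "val n [Y, X, Xs 1] = [2 \<mapsto> n]" "val n [Xs 1, Y, X] = [2 \<mapsto> n]"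
  "val n (replicate (n - 2) X @ [E (n - 1)]) = [2 \<mapsto> n]"
  using n4 by (auto simp: val_simps)

lemma val_V13_x:
  assumes "2 \<le> i" "2 * i < n"
  shows "val n [Y, X, Xs i] = [i + 1 \<mapsto> n - i + 1]" "val n [Xs i, Y, X] = [i + 1 \<mapsto> n - i + 1]"
  "val n (replicate (n - 2 * i) X @ Es (n - 2 * i + 1) (n - i) @ Es (n - i + 2) (n - 1) @ [X, Y]) = [i + 1 \<mapsto> n - i + 1]"
  using assms by (auto simp: val_simps)

lemma val_V13_y:
  assumes "1 \<le> i" "2 * i < n"
  shows "val n [Y, X, Ys i] = [n - i + 1 \<mapsto> i + 1]" "val n [Ys i, Y, X] = [n - i + 1 \<mapsto> i + 1]"
  "val n (replicate (n - 2 * i + 1) Y @ [X] @ Es 2 i @ Es (i + 2) (2 * i)) = [n - i + 1 \<mapsto> i + 1]"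
  using assms by (auto simp: val_simps)

lemma val_V13:
  assumes "(u, v) \<in> V13 n"
  shows "val n u = val n v"
proof -
  have V1: "val n u = val n v"
    if "(u, v) \<in> chain [[Y, X, Xs 1], [Xs 1, Y, X], replicate (n - 2) X @ [E (n - 1)]]"
    using that by (rule val_chain) (simp only: list.set ball_simps val_V13_x1 simp_thms)
  have V2: "val n u = val n v"
    if "i \<in> {2..m_of n}" "(u, v) \<in> chain [[Y, X, Xs i], [Xs i, Y, X], replicate (n - 2 * i) X @
      Es (n - 2 * i + 1) (n - i) @ Es (n - i + 2) (n - 1) @ [X, Y]]" for i
  proof -
    have i: "2 \<le> i" "2 * i < n"
      using that(1) by (simp_all add: le_m_of_iff)
    from that(2) show ?thesis
      by (rule val_chain) (simp only: list.set ball_simps val_V13_x[OF i] simp_thms)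
  qed
  have V3: "val n u = val n v"
    if "i \<in> {1..m_of n}" "(u, v) \<in> chain [[Y, X, Ys i], [Ys i, Y, X],
      replicate (n - 2 * i + 1) Y @ [X] @ Es 2 i @ Es (i + 2) (2 * i)]" for i
  proof -
    have i: "1 \<le> i" "2 * i < n"
      using that(1) by (simp_all add: le_m_of_iff)
    from that(2) show ?thesis
      by (rule val_chain) (simp only: list.set ball_simps val_V13_y[OF i] simp_thms)
  qed
  from assms show ?thesis
    unfolding V13_def by (elim UnE UN_E) (fact V1, erule (1) V2, erule (1) V3)
qed

lemma val_V14: "(u, v) \<in> V14 n \<Longrightarrow> val n u = val n v"
  using n4 by (auto simp: V14_def chain_def val_simps)

lemma val_relations: "(u, v) \<in> relations n \<Longrightarrow> val n u = val n v"
  unfolding relations_def Un_iff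
  using val_V1_to_V5[of u v] val_V6_V7[of u v] val_V8[of u v]
    val_V9[of u v] val_V10[of u v] val_V11[of u v]
    val_V12[of u v] val_V13[of u v] val_V14[of u v]
  by blast

end

section \<open>The represented maps separate the normal forms\<close>

lemma val_trans_word_shift:
  assumes "u \<in> trans_words n" "val n u i = Some j" "val n u i' = Some j'"
  shows "j + i' = j' + i"
  using assms by (auto simp: trans_words_def val_up_word val_down_word split: if_splits)

text \<open>A translation keeps distances, whereas a flip changes \<open>d\<close> to
  \<open>n - d\<close>, which is different because \<open>2 * d \<noteq> n\<close>.\<close>

lemma val_trans_word_neq_flip_word:
  assumes "u \<in> trans_words n" "v \<in> flip_words n"
  shows "val n u \<noteq> val n v"
proof
  assume eq: "val n u = val n v"
  obtain a d c where d: "1 \<le> d" "2 * d \<noteq> n" "a + d < n" "c < d" and v: "v = flip_word n a d c"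
    using assms(2) by (auto simp: flip_words_def)
  have "val n u (a + 1) = Some (c + 1)" "val n u (a + d + 1) = Some (n - d + c + 1)"
    using d by (simp_all add: eq v val_flip_word)
  from val_trans_word_shift[OF assms(1) this] show False
    using d by simp
qed

text \<open>The domain determines \<open>a\<close> and \<open>d\<close>, since \<open>d\<close> is
  positive; the image of its smaller point then determines \<open>c\<close>.\<close>

lemma val_flip_word_inject:
  assumes "1 \<le> d" "a + d < n" "c < d" "1 \<le> d'" "a' + d' < n" "c' < d'"
    and "val n (flip_word n a d c) = val n (flip_word n a' d' c')"
  shows "flip_word n a d c = flip_word n a' d' c'"
proof -
  have eq: "[a + 1 \<mapsto> c + 1, a + d + 1 \<mapsto> n - d + c + 1] =
    [a' + 1 \<mapsto> c' + 1, a' + d' + 1 \<mapsto> n - d' + c' + 1]"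
    using assms by (simp only: val_flip_word)
  have "dom [p \<mapsto> q, r \<mapsto> s] = {p, r}" for p q r s :: nat
    by auto
  with arg_cong[OF eq, of dom] have "{a + 1, a + d + 1} = {a' + 1, a' + d' + 1}"
    by (simp only:)
  then have "a = a'" "d = d'"
    using assms(1,4) by (auto simp: doubleton_eq_iff)
  moreover have "c = c'"
    using fun_cong[OF eq, of "a + 1"] calculation assms(1) by simp
  ultimately show ?thesis
    by simp
qed

context ODI_relations
begin

text \<open>One pair of points fixes the shift and hence the exponent. A \<open>down_word\<close>
  fits only with exponent 0, where it also counts as \<open>x ^ 0\<close>.\<close>

lemma ev_up_form:
  assumes "u \<in> trans_words n" "val n u i = Some j" "i \<le> j"
  obtains l where "set l \<subseteq> {1..n}" "ev u = P l * x ^ (j - i)"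
    "\<And>i'. val n u i' = None \<longleftrightarrow> \<not> (1 \<le> i' \<and> i' + (j - i) \<le> n \<and> i' \<notin> set l)"
proof -
  from assms(1) consider (up) l k where "u = up_word n l k" "set l \<subseteq> {1..n}"
    | (down) l k where "u = down_word n l k" "set l \<subseteq> {1..n}"
    by (auto simp: trans_words_def)
  then show ?thesis
  proof cases
    case up
    then have "k = j - i"
      using assms by (auto simp: val_up_word split: if_splits)
    then show ?thesis
      using that[of l] up by (auto simp: ev_up_word val_up_word)
  next
    case down
    then have 0: "k = 0" "j - i = 0"
      using assms by (auto simp: val_down_word split: if_splits)
    show ?thesis
      by (rule that[OF down(2)]) (auto simp: down(1) 0 ev_down_word val_down_word)
  qed
qed

lemma ev_down_form:
  assumes "u \<in> trans_words n" "val n u i = Some j" "j \<le> i"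
  obtains l where "set l \<subseteq> {1..n}" "ev u = P l * y ^ (i - j)"
    "\<And>i'. val n u i' = None \<longleftrightarrow> \<not> (i - j < i' \<and> i' \<le> n \<and> i' \<notin> set l)"
proof -
  from assms(1) consider (up) l k where "u = up_word n l k" "set l \<subseteq> {1..n}"
    | (down) l k where "u = down_word n l k" "set l \<subseteq> {1..n}"
    by (auto simp: trans_words_def)
  then show ?thesis
  proof cases
    case down
    then have "k = i - j"
      using assms by (auto simp: val_down_word split: if_splits)
    then show ?thesis
      using that[of l] down by (auto simp: ev_down_word val_down_word)
  next
    case up
    then have 0: "k = 0" "i - j = 0"
      using assms by (auto simp: val_up_word split: if_splits)
    show ?thesis
      by (rule that[OF up(2)]) (auto simp: up(1) 0 ev_up_word val_up_word)
  qed
qed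

lemma ev_zero:
  assumes "u \<in> trans_words n" "\<And>i. val n u i = None"
  shows "ev u = z"
proof -
  from assms(1) consider (up) l k where "u = up_word n l k" "set l \<subseteq> {1..n}"
    | (down) l k where "u = down_word n l k" "set l \<subseteq> {1..n}"
    by (auto simp: trans_words_def)
  then show ?thesis
  proof cases
    case up
    have "i \<in> set l" if "1 \<le> i" "i + k \<le> n" for i
      using assms(2)[of i] that up(1) by (auto simp: val_up_word split: if_splits)
    then show ?thesis
      using up_zero[OF up(2)] up(1) by (simp add: ev_up_word)
  next
    case down
    have "i \<in> set l" if "k < i" "i \<le> n" for i
      using assms(2)[of i] that down(1) by (auto simp: val_down_word split: if_splits)
    then show ?thesis
      using down_zero[OF down(2)] down(1) by (simp add: ev_down_word)
  qed
qed

text \<open>In a nonempty map any pair of points fixes the shift, and the domain fixes the indices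
  that matter. The empty map determines no shift, so there both values are identified with
  \<open>z\<close>.\<close>

lemma ev_trans_cong:
  assumes u: "u \<in> trans_words n" and v: "v \<in> trans_words n" and eq: "val n u = val n v"
  shows "ev u = ev v"
proof (cases "\<forall>i. val n u i = None")
  case True
  then show ?thesis
    using ev_zero[OF u] ev_zero[OF v] eq by simp
next
  case False
  then obtain i j where ij: "val n u i = Some j" "val n v i = Some j"
    using eq by auto
  show ?thesis
  proof (cases "i \<le> j")
    case True
    obtain l where l: "set l \<subseteq> {1..n}" "ev u = P l * x ^ (j - i)"
      "\<And>i'. val n u i' = None \<longleftrightarrow> \<not> (1 \<le> i' \<and> i' + (j - i) \<le> n \<and> i' \<notin> set l)"
      using ev_up_form[OF u ij(1) True] by metis
    obtain l' where l': "set l' \<subseteq> {1..n}" "ev v = P l' * x ^ (j - i)"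
      "\<And>i'. val n v i' = None \<longleftrightarrow> \<not> (1 \<le> i' \<and> i' + (j - i) \<le> n \<and> i' \<notin> set l')"
      using ev_up_form[OF v ij(2) True] by metis
    show ?thesis
      unfolding l(2) l'(2) using l(3) l'(3) eq by (intro up_eq[OF l(1) l'(1)]) metis
  next
    case False
    then have ji: "j \<le> i"
      by simp
    obtain l where l: "set l \<subseteq> {1..n}" "ev u = P l * y ^ (i - j)"
      "\<And>i'. val n u i' = None \<longleftrightarrow> \<not> (i - j < i' \<and> i' \<le> n \<and> i' \<notin> set l)"
      using ev_down_form[OF u ij(1) ji] by metis
    obtain l' where l': "set l' \<subseteq> {1..n}" "ev v = P l' * y ^ (i - j)"
      "\<And>i'. val n v i' = None \<longleftrightarrow> \<not> (i - j < i' \<and> i' \<le> n \<and> i' \<notin> set l')"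
      using ev_down_form[OF v ij(2) ji] by metis
    show ?thesis
      unfolding l(2) l'(2) using l(3) l'(3) eq by (intro down_eq[OF l(1) l'(1)]) metis
  qed
qed

lemma ev_normal_cong:
  assumes "u \<in> trans_words n \<union> flip_words n" "v \<in> trans_words n \<union> flip_words n"
    and eq: "val n u = val n v"
  shows "ev u = ev v"
proof -
  have "\<not> (u \<in> trans_words n \<and> v \<in> flip_words n)" "\<not> (v \<in> trans_words n \<and> u \<in> flip_words n)"
    using val_trans_word_neq_flip_word eq by metis+
  then consider "u \<in> trans_words n" "v \<in> trans_words n" | "u \<in> flip_words n" "v \<in> flip_words n"
    using assms(1,2) by blast
  then show ?thesis
  proof cases
    case 2
    then obtain a d c a' d' c' where "u = flip_word n a d c" "v = flip_word n a' d' c'"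
      and "1 \<le> d" "a + d < n" "c < d" "1 \<le> d'" "a' + d' < n" "c' < d'"
      unfolding flip_words_def mem_Collect_eq by (elim exE conjE) metis
    then show ?thesis
      using val_flip_word_inject[of d a n c d' a' c'] eq by simp
  qed (use eq ev_trans_cong in blast)
qed

end

section \<open>The elements of the monoid\<close>

lemma ODI_I:
  assumes "\<sigma> \<in> dihedral n" "A \<subseteq> {1..n}" "\<alpha> = (\<lambda>i. if i \<in> A then Some (\<sigma> i) else None)"
    and "mono_on A \<sigma>"
  shows "\<alpha> \<in> carrier (ODI n)"
proof -
  have "order_preserving \<alpha>"
    using assms(3,4) by (auto simp: order_preserving_def dom_def mono_on_def split: if_splits)
  then show ?thesis
    using assms(1-3) by (auto simp: ODI_def DI_def)
qed

lemma ODI_E: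
  assumes "\<alpha> \<in> carrier (ODI n)"
  obtains \<sigma> A where "\<sigma> \<in> dihedral n" "A \<subseteq> {1..n}" "\<alpha> = (\<lambda>i. if i \<in> A then Some (\<sigma> i) else None)"
    "mono_on A \<sigma>"
proof -
  obtain \<sigma> A where *: "\<sigma> \<in> dihedral n" "A \<subseteq> {1..n}" "\<alpha> = (\<lambda>i. if i \<in> A then Some (\<sigma> i) else None)"
    and "order_preserving \<alpha>"
    using assms by (auto simp: ODI_def DI_def)
  moreover have "mono_on A \<sigma>"
  proof (rule mono_onI)
    fix i j assume that: "i \<in> A" "j \<in> A" "i \<le> j"
    have "the (\<alpha> i) \<le> the (\<alpha> j)"
    proof -
      have "i \<in> dom \<alpha>" "j \<in> dom \<alpha>"
        using that *(3) by auto
      then show ?thesis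
        using \<open>order_preserving \<alpha>\<close> that(3) unfolding order_preserving_def by blast
    qed
    then show "\<sigma> i \<le> \<sigma> j"
      using that *(3) by simp
  qed
  ultimately show ?thesis
    using that by blast
qed

section \<open>Dihedral permutations as affine maps modulo \<open>n\<close>\<close>

lemma dihedral_comp: "\<sigma> \<in> dihedral n \<Longrightarrow> \<tau> \<in> dihedral n \<Longrightarrow> \<sigma> \<circ> \<tau> \<in> dihedral n"
  and dihedral_id: "id \<in> dihedral n"
  and dihedral_rotation: "rotation n \<in> dihedral n"
  and dihedral_reflection: "reflection n \<in> dihedral n"
  unfolding dihedral_def
  using generate.eng[of \<sigma> "sym_group n" _ \<tau>] generate.one[of "sym_group n"]
  by (auto simp: sym_group_mult sym_group_one intro: generate.incl)

lemma rotation_permutes: "rotation n permutes {1..n}"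
proof (rule bij_imp_permutes)
  show "bij_betw (rotation n) {1..n} {1..n}"
    by (rule bij_betw_byWitness[where f' = "\<lambda>i. if i = 1 then n else i - 1"])
       (auto simp: rotation_def)
qed (auto simp: rotation_def)

lemma reflection_permutes: "reflection n permutes {1..n}"
proof (rule bij_imp_permutes)
  show "bij_betw (reflection n) {1..n} {1..n}"
    by (rule bij_betw_byWitness[where f' = "reflection n"]) (auto simp: reflection_def)
qed (auto simp: reflection_def)

text \<open>A congruence instead of an equation, because residues are represented by
  \<open>{1..n}\<close>. The sign \<open>s\<close> is the orientation: 1 for rotations, -1 for
  reflections.\<close>

definition affine_mod :: "nat \<Rightarrow> int \<Rightarrow> int \<Rightarrow> (nat \<Rightarrow> nat) \<Rightarrow> bool" where
  "affine_mod n s k \<sigma> \<longleftrightarrow> s \<in> {1, - 1} \<and> \<sigma> permutes {1..n} \<and>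
     (\<forall>i\<in>{1..n}. int n dvd int (\<sigma> i) - (s * int i + k))"

lemma affine_mod_rotation: "affine_mod n 1 1 (rotation n)"
  using rotation_permutes by (auto simp: affine_mod_def rotation_def)

lemma affine_mod_reflection: "affine_mod n (- 1) (int n + 1) (reflection n)"
  using reflection_permutes by (auto simp: affine_mod_def reflection_def of_nat_diff)

lemma affine_mod_comp:
  assumes "affine_mod n s k \<sigma>" "affine_mod n s' k' \<tau>"
  shows "affine_mod n (s * s') (s * k' + k) (\<sigma> \<circ> \<tau>)"
  unfolding affine_mod_def
proof (intro conjI ballI)
  fix i assume i: "i \<in> {1..n}"
  then have "\<tau> i \<in> {1..n}"
    using assms(2) permutes_in_image[of \<tau> "{1..n}" i] by (simp add: affine_mod_def)
  then have "int n dvd int (\<sigma> (\<tau> i)) - (s * int (\<tau> i) + k)"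
    "int n dvd s * (int (\<tau> i) - (s' * int i + k'))"
    using assms i by (auto simp: affine_mod_def)
  from dvd_add[OF this] show "int n dvd int ((\<sigma> \<circ> \<tau>) i) - (s * s' * int i + (s * k' + k))"
    by (simp add: algebra_simps)
qed (use assms in \<open>auto simp: affine_mod_def intro: permutes_compose\<close>)

lemma affine_mod_inv:
  assumes "affine_mod n s k \<sigma>"
  shows "affine_mod n s (- (s * k)) (inv' \<sigma>)"
  unfolding affine_mod_def
proof (intro conjI ballI)
  have p: "\<sigma> permutes {1..n}" and s: "s * s = 1"
    using assms by (auto simp: affine_mod_def)
  fix i assume i: "i \<in> {1..n}"
  define j where "j = inv' \<sigma> i"
  have j: "j \<in> {1..n}" "\<sigma> j = i"
    using i permutes_in_image[OF permutes_inv[OF p]] permutes_inverses(1)[OF p]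
    by (simp_all add: j_def)
  then have "int n dvd int i - (s * int j + k)"
    using assms unfolding affine_mod_def by blast
  \<comment> \<open>Since \<open>s * s = 1\<close>, multiplying by \<open>- s\<close> solves the
    congruence for \<open>j\<close>.\<close>
  then have "int n dvd (- s) * (int i - (s * int j + k))"
    by (rule dvd_mult)
  also have "(- s) * (int i - (s * int j + k)) = (s * s) * int j - (s * int i - s * k)"
    by (simp add: algebra_simps)
  finally show "int n dvd int (inv' \<sigma> i) - (s * int i + - (s * k))"
    by (simp add: s j_def)
qed (use assms in \<open>auto simp: affine_mod_def intro: permutes_inv\<close>)

lemma dihedral_affine_mod: "\<sigma> \<in> dihedral n \<Longrightarrow> \<exists>s k. affine_mod n s k \<sigma>"
  unfolding dihedral_def
proof (induction rule: generate.induct)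
  case one
  have "affine_mod n 1 0 id"
    by (auto simp: affine_mod_def permutes_id)
  then show ?case
    unfolding sym_group_one by blast
next
  case (incl h)
  then show ?case
    using affine_mod_rotation affine_mod_reflection by auto
next
  case (inv h)
  have "inv\<^bsub>sym_group n\<^esub> h = inv' h"
    using inv rotation_permutes reflection_permutes
    by (intro sym_group_inv_equality) (auto simp: sym_group_carrier)
  moreover have "\<exists>s k. affine_mod n s k h"
    using inv affine_mod_rotation affine_mod_reflection by auto
  ultimately show ?case
    using affine_mod_inv by metis
next
  case (eng h1 h2)
  then show ?case
    unfolding sym_group_mult using affine_mod_comp by blast
qed

section \<open>Words represent elements of the monoid\<close>

lemma ODI_comp:
  assumes "\<alpha> \<in> carrier (ODI n)" "\<beta> \<in> carrier (ODI n)"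
  shows "\<beta> \<circ>\<^sub>m \<alpha> \<in> carrier (ODI n)"
proof -
  obtain \<sigma> A where \<sigma>: "\<sigma> \<in> dihedral n" "A \<subseteq> {1..n}"
    "\<alpha> = (\<lambda>i. if i \<in> A then Some (\<sigma> i) else None)"
    "mono_on A \<sigma>"
    by (rule ODI_E[OF assms(1)])
  obtain \<tau> B where \<tau>: "\<tau> \<in> dihedral n" "B \<subseteq> {1..n}"
    "\<beta> = (\<lambda>i. if i \<in> B then Some (\<tau> i) else None)"
    "mono_on B \<tau>"
    by (rule ODI_E[OF assms(2)])
  show ?thesis
  proof (rule ODI_I[OF dihedral_comp[OF \<tau>(1) \<sigma>(1)]])
    show "{i \<in> A. \<sigma> i \<in> B} \<subseteq> {1..n}"
      using \<sigma>(2) by auto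
    show "\<beta> \<circ>\<^sub>m \<alpha> = (\<lambda>i. if i \<in> {i \<in> A. \<sigma> i \<in> B} then Some ((\<tau> \<circ> \<sigma>) i) else None)"
      by (auto simp: \<sigma>(3) \<tau>(3) map_comp_def fun_eq_iff)
  qed (use \<sigma>(4) \<tau>(4) in \<open>auto simp: mono_on_def\<close>)
qed

lemma ODI_simps:
  "mult (ODI n) = (\<lambda>\<alpha> \<beta>. \<beta> \<circ>\<^sub>m \<alpha>)" "one (ODI n) = val n []"
  by (simp_all add: ODI_def DI_def sym_inv_monoid_def)

lemma ODI_restrict_id:
  assumes "A \<subseteq> {1..n}" shows "(\<lambda>i. if i \<in> A then Some i else None) \<in> carrier (ODI n)"
  using assms by (intro ODI_I[OF dihedral_id]) (auto simp: mono_on_def)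

lemma letter_map_ODI:
  assumes "b \<in> alphabet n"
  shows "letter_map n b \<in> carrier (ODI n)"
proof -
  let ?r = "rotation n" and ?s = "reflection n"
  note dih = dihedral_comp dihedral_rotation dihedral_reflection
  have m: "1 \<le> i" "2 * i < n" if "i \<in> {1..m_of n}" for i
    using that by (auto simp: m_of_def)
  show ?thesis
  proof (cases b)
    case X
    show ?thesis
      by (rule ODI_I[of ?r n "{1..<n}"])
         (auto simp: mono_on_def X dih letter_map_def rotation_def fun_eq_iff)
  next
    case Y
    \<comment> \<open>Conjugating the rotation by the reflection gives its inverse, which lowers the
      points of \<open>{2..n}\<close> by one.\<close>
    show ?thesis
      by (rule ODI_I[of "?s \<circ> ?r \<circ> ?s" n "{2..n}"])
         (auto simp: mono_on_def Y dih letter_map_def rotation_def reflection_def fun_eq_iff)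
  next
    case (E j)
    have "letter_map n b = (\<lambda>i. if i \<in> {1..n} - {j} then Some i else None)"
      by (auto simp: E letter_map_def)
    moreover have "{1..n} - {j} \<subseteq> {1..n}"
      by blast
    ultimately show ?thesis
      by (simp only: ODI_restrict_id)
  next
    case (Xs i)
    then have "i \<in> {1..m_of n}"
      using assms by (auto simp: alphabet_def)
    note i = m[OF this]
    \<comment> \<open>This is the reflection that fixes 1 and exchanges \<open>i + 1\<close> with
      \<open>n - i + 1\<close>; it serves for \<open>Ys i\<close> as well.\<close>
    have v: "(?r \<circ> ?s) 1 = 1" "(?r \<circ> ?s) (i + 1) = n - i + 1"
      using i by (auto simp: rotation_def reflection_def)
    show ?thesis
    proof (rule ODI_I[of "?r \<circ> ?s" n "{1, i + 1}"])
      show "letter_map n b = (\<lambda>k. if k \<in> {1, i + 1} then Some ((?r \<circ> ?s) k) else None)"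
        using i v by (auto simp: fun_eq_iff Xs letter_map_def simp del: comp_apply)
      show "mono_on {1, i + 1} (?r \<circ> ?s)"
        unfolding mono_on_def using v by (auto simp del: comp_apply)
      show "?r \<circ> ?s \<in> dihedral n"
        by (intro dih)
    qed (use i in simp)
  next
    case (Ys i)
    then have "i \<in> {1..m_of n}"
      using assms by (auto simp: alphabet_def)
    note i = m[OF this]
    have v: "(?r \<circ> ?s) 1 = 1" "(?r \<circ> ?s) (n - i + 1) = i + 1"
      using i by (auto simp: rotation_def reflection_def)
    show ?thesis
    proof (rule ODI_I[of "?r \<circ> ?s" n "{1, n - i + 1}"])
      show "letter_map n b = (\<lambda>k. if k \<in> {1, n - i + 1} then Some ((?r \<circ> ?s) k) else None)"
        using i v by (auto simp: fun_eq_iff Ys letter_map_def simp del: comp_apply)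
      show "mono_on {1, n - i + 1} (?r \<circ> ?s)"
        unfolding mono_on_def using v by (auto simp del: comp_apply)
      show "?r \<circ> ?s \<in> dihedral n"
        by (intro dih)
    qed (use i in simp)
  qed
qed

lemma val_Cons_comp: "val n (b # w) = val n w \<circ>\<^sub>m letter_map n b"
  by (auto simp: map_comp_def fun_eq_iff split: option.splits)

lemma val_append_comp: "val n (u @ v) = val n v \<circ>\<^sub>m val n u"
  by (auto simp: map_comp_def fun_eq_iff val_append split: option.splits)

lemma val_ODI: "w \<in> lists (alphabet n) \<Longrightarrow> val n w \<in> carrier (ODI n)"
proof (induction w)
  case Nil
  then show ?case
    using ODI_restrict_id[of "{1..n}" n] by simp
next
  case (Cons b w)
  then show ?case
    unfolding val_Cons_comp by (intro ODI_comp letter_map_ODI) auto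
qed

section \<open>Every element is represented by a normal form\<close>

lemma trans_word_of_shift:
  assumes dom: "dom \<alpha> \<subseteq> {1..n}" and ran: "ran \<alpha> \<subseteq> {1..n}"
    and shift: "\<And>i j. \<alpha> i = Some j \<Longrightarrow> int j = int i + \<delta>"
  shows "\<exists>w\<in>trans_words n. val n w = \<alpha>"
proof -
  obtain l where l: "set l = {1..n} - dom \<alpha>"
    using finite_list[of "{1..n} - dom \<alpha>"] by auto
  have some: "1 \<le> i \<and> i \<le> n \<and> 1 \<le> j \<and> j \<le> n \<and> int j = int i + \<delta>" if "\<alpha> i = Some j" for i j
    using shift[OF that] domI[of \<alpha>, OF that] ranI[of \<alpha>, OF that] dom ran by fastforce
  have notin: "i \<notin> set l \<longleftrightarrow> i \<in> dom \<alpha>" if "1 \<le> i" "i \<le> n" for i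
    using l that by auto
  show ?thesis
  proof (cases "0 \<le> \<delta>")
    case True
    have "val n (up_word n l (nat \<delta>)) i = \<alpha> i" for i
    proof (cases "\<alpha> i")
      case None
      then show ?thesis
        using notin[of i] by (auto simp: val_up_word)
    next
      case (Some j)
      from some[OF this] have "1 \<le> i" "i \<le> n" "i + nat \<delta> = j" "j \<le> n"
        using True by auto
      then show ?thesis
        using Some notin[of i] by (auto simp: val_up_word)
    qed
    moreover have "up_word n l (nat \<delta>) \<in> trans_words n"
      using l unfolding trans_words_def by blast
    ultimately show ?thesis
      by blast
  next
    case False
    have "val n (down_word n l (nat (- \<delta>))) i = \<alpha> i" for i
    proof (cases "\<alpha> i")
      case None
      then show ?thesis
        using notin[of i] by (auto simp: val_down_word)
    next
      case (Some j)
      from some[OF this] have "nat (- \<delta>) < i" "1 \<le> i" "i \<le> n" "i - nat (- \<delta>) = j"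
        using False by auto
      then show ?thesis
        using Some notin[of i] by (auto simp: val_down_word)
    qed
    moreover have "down_word n l (nat (- \<delta>)) \<in> trans_words n"
      using l unfolding trans_words_def by blast
    ultimately show ?thesis
      by blast
  qed
qed

lemma int_dvd_bounded_eq_0: "int n dvd t \<Longrightarrow> \<bar>t\<bar> < int n \<Longrightarrow> t = 0"
  using dvd_imp_le_int[of t "int n"] by force

text \<open>Distances of points and of their images lie strictly between 0 and \<open>n\<close>, so
  the congruences become equations. Orientation 1 keeps every distance; orientation -1 makes the
  distance of two points and that of their images add up to \<open>n\<close>, which leaves room for
  at most two points.\<close>

lemma ODI_normal_word:
  assumes "\<alpha> \<in> carrier (ODI n)"
  shows "\<exists>w\<in>trans_words n \<union> flip_words n. val n w = \<alpha>"
proof -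
  obtain \<sigma> A where \<sigma>: "\<sigma> \<in> dihedral n" and A: "A \<subseteq> {1..n}"
    and \<alpha>: "\<alpha> = (\<lambda>i. if i \<in> A then Some (\<sigma> i) else None)" and mono: "mono_on A \<sigma>"
    by (rule ODI_E[OF assms])
  obtain s k where sk: "affine_mod n s k \<sigma>"
    using dihedral_affine_mod[OF \<sigma>] by blast
  have perm: "\<sigma> permutes {1..n}" and s: "s = 1 \<or> s = - 1"
    using sk by (auto simp: affine_mod_def)
  have range: "1 \<le> i \<and> i \<le> n \<and> 1 \<le> \<sigma> i \<and> \<sigma> i \<le> n" if "i \<in> A" for i
    using permutes_in_image[OF perm, of i] A that by auto
  have less: "\<sigma> i < \<sigma> j" if "i \<in> A" "j \<in> A" "i < j" for i j
    using mono_onD[OF mono that(1,2)] that(3) permutes_inj[OF perm, THEN injD, of i j] by force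
  have cong: "int n dvd (int (\<sigma> j) - int (\<sigma> i)) - s * (int j - int i)" if "i \<in> A" "j \<in> A" for i j
  proof -
    have "int n dvd int (\<sigma> i) - (s * int i + k)" "int n dvd int (\<sigma> j) - (s * int j + k)"
      using sk A that unfolding affine_mod_def by blast+
    from dvd_diff[OF this(2,1)] show ?thesis
      by (simp add: algebra_simps)
  qed
  have shift: ?thesis
    if eq: "\<And>i j. i \<in> A \<Longrightarrow> j \<in> A \<Longrightarrow> i < j \<Longrightarrow> int (\<sigma> j) - int (\<sigma> i) = int j - int i"
  proof -
    have "\<exists>\<delta>. \<forall>i\<in>A. int (\<sigma> i) = int i + \<delta>"
    proof (cases "A = {}")
      case False
      then obtain a where a: "a \<in> A"
        by auto
      have "int (\<sigma> i) = int i + (int (\<sigma> a) - int a)" if "i \<in> A" for i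
        using eq[OF a that] eq[OF that a] by (cases i a rule: linorder_cases) auto
      then show ?thesis
        by blast
    qed simp
    then obtain \<delta> where "\<forall>i\<in>A. int (\<sigma> i) = int i + \<delta>"
      by blast
    then have "\<exists>w\<in>trans_words n. val n w = \<alpha>"
      by (intro trans_word_of_shift[where \<delta> = \<delta>])
         (use range in \<open>auto simp: \<alpha> ran_def split: if_splits\<close>)
    then show ?thesis
      by blast
  qed
  show ?thesis
  proof (cases "s = 1")
    case True
    show ?thesis
    proof (rule shift)
      fix i j assume ij: "i \<in> A" "j \<in> A" "i < j"
      then have "\<bar>(int (\<sigma> j) - int (\<sigma> i)) - (int j - int i)\<bar> < int n"
        using less[OF ij] range[OF ij(1)] range[OF ij(2)] by linarith
      moreover have "int n dvd (int (\<sigma> j) - int (\<sigma> i)) - (int j - int i)"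
        using cong[OF ij(1,2)] True by simp
      ultimately have "(int (\<sigma> j) - int (\<sigma> i)) - (int j - int i) = 0"
        using int_dvd_bounded_eq_0 by blast
      then show "int (\<sigma> j) - int (\<sigma> i) = int j - int i"
        by simp
    qed
  next
    case False
    have flip: "\<sigma> j + j = \<sigma> i + i + n" if ij: "i \<in> A" "j \<in> A" "i < j" for i j
    proof -
      \<comment> \<open>The sum of the two distances lies between 2 and \<open>2 * n - 2\<close>;
        subtracting \<open>n\<close> brings it within reach of
        \<open>int_dvd_bounded_eq_0\<close>.\<close>
      have "int n dvd (int (\<sigma> j) - int (\<sigma> i)) - s * (int j - int i) - int n"
        using cong[OF ij(1,2)] by (rule dvd_diff) simp
      moreover have "(int (\<sigma> j) - int (\<sigma> i)) - s * (int j - int i) - int n =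
          int (\<sigma> j) - int (\<sigma> i) + (int j - int i) - int n"
        using False s by simp
      moreover have "\<bar>int (\<sigma> j) - int (\<sigma> i) + (int j - int i) - int n\<bar> < int n"
        using less[OF ij] ij(3) range[OF ij(1)] range[OF ij(2)] by linarith
      ultimately have "int (\<sigma> j) - int (\<sigma> i) + (int j - int i) - int n = 0"
        using int_dvd_bounded_eq_0 by metis
      then show ?thesis
        by linarith
    qed
    show ?thesis
    proof (cases "\<exists>i\<in>A. \<exists>j\<in>A. i < j \<and> 2 * (j - i) \<noteq> n")
      case True
      then obtain i j where ij: "i \<in> A" "j \<in> A" "i < j" "2 * (j - i) \<noteq> n"
        by blast
      have A_eq: "A = {i, j}"
      proof (intro equalityI subsetI)
        fix p assume p: "p \<in> A"
        \<comment> \<open>The pairs \<open>a\<close>, \<open>b\<close> and \<open>b\<close>,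
          \<open>c\<close> contribute \<open>n\<close> each, so the pair \<open>a\<close>,
          \<open>c\<close> would give \<open>2 * n\<close> instead of \<open>n\<close>.\<close>
        have three: False if "a \<in> A" "b \<in> A" "c \<in> A" "a < b" "b < c" for a b c
          using flip[OF that(1,2,4)] flip[OF that(2,3,5)] flip[OF that(1,3)] that(4,5) range[OF that(1)]
          by simp
        have "\<not> p < i" "\<not> j < p" "\<not> (i < p \<and> p < j)"
          using three[OF p ij(1,2)] three[OF ij(1,2) p] three[OF ij(1) p ij(2)] ij(3) by blast+
        then show "p \<in> {i, j}"
          by (metis insertCI linorder_neqE_nat)
      qed (use ij in auto)
      define d where "d = j - i"
      \<comment> \<open>In a flip word the smaller point is \<open>a + 1\<close> and its image is
        \<open>c + 1\<close>, hence the subtractions of 1.\<close>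
      let ?w = "flip_word n (i - 1) d (\<sigma> i - 1)"
      have j: "j = i + d" "\<sigma> j + d = \<sigma> i + n" and d: "1 \<le> d" "2 * d \<noteq> n"
        using ij(3,4) flip[OF ij(1-3)] by (simp_all add: d_def)
      have bounds: "i - 1 + d < n" "\<sigma> i - 1 < d"
        using j range[OF ij(1)] range[OF ij(2)] by linarith+
      have "val n ?w = [i \<mapsto> \<sigma> i, j \<mapsto> \<sigma> j]"
      proof -
        have "i - 1 + 1 = i" "i - 1 + d + 1 = j" "\<sigma> i - 1 + 1 = \<sigma> i" "n - d + (\<sigma> i - 1) + 1 = \<sigma> j"
          using j bounds range[OF ij(1)] by linarith+
        then show ?thesis
          by (simp only: val_flip_word[OF d(1) bounds])
      qed
      also have "\<dots> = \<alpha>"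
        by (auto simp: \<alpha> A_eq fun_eq_iff)
      finally have "val n ?w = \<alpha>" .
      moreover have "?w \<in> flip_words n"
        unfolding flip_words_def using d bounds by blast
      ultimately show ?thesis
        by blast
    next
      case False
      \<comment> \<open>There remain domains with at most one point and pairs at distance
        \<open>n / 2\<close>; on these a reflection keeps the distance and acts as a
        translation.\<close>
      show ?thesis
      proof (rule shift)
        fix i j assume ij: "i \<in> A" "j \<in> A" "i < j"
        with False have "2 * (j - i) = n"
          by blast
        then show "int (\<sigma> j) - int (\<sigma> i) = int j - int i"
          using flip[OF ij] ij(3) by linarith
      qed
    qed
  qed
qed

section \<open>Cardinalities\<close>

lemma pairs_disjointI: "(\<And>u v. (u, v) \<in> A \<Longrightarrow> (u, v) \<in> B \<Longrightarrow> False) \<Longrightarrow> A \<inter> B = {}"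
  by auto

lemma card_UN_constant:
  assumes "finite I" "\<And>i. i \<in> I \<Longrightarrow> finite (S i)" "\<And>i. i \<in> I \<Longrightarrow> card (S i) = c"
    and "\<And>i j. i \<in> I \<Longrightarrow> j \<in> I \<Longrightarrow> i \<noteq> j \<Longrightarrow> S i \<inter> S j = {}"
  shows "card (\<Union>i\<in>I. S i) = card I * c"
  using assms by (subst card_UN_disjoint) auto

context
  fixes n :: nat
  assumes n4: "4 \<le> n"
begin

text \<open>No two relations have the same left-hand side, so the families are disjoint.\<close>

lemma lhs_V1: "(u, v) \<in> V1 n \<Longrightarrow> \<exists>i. u = [E i, E i]"
  by (auto simp: V1_def chain_def)

lemma lhs_V2: "(u, v) \<in> V2 \<Longrightarrow> u = [X, Y, X] \<or> u = [Y, X, Y]"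
  by (auto simp: V2_def chain_def)

lemma lhs_V3: "(u, v) \<in> V3 \<Longrightarrow> u = [Y, X, X, Y]"
  by (auto simp: V3_def chain_def)

lemma lhs_V4: "(u, v) \<in> V4 n \<Longrightarrow> \<exists>i j. i < j \<and> u = [E i, E j]"
  by (auto simp: V4_def chain_def)

lemma lhs_V5: "(u, v) \<in> V5 n \<Longrightarrow> \<exists>i. u = [X, Y, E i] \<or> u = [Y, X, E i]"
  by (auto simp: V5_def chain_def)

lemma lhs_V6: "(u, v) \<in> V6 n \<Longrightarrow> \<exists>i. u = [X, E i]"
  by (auto simp: V6_def chain_def)

lemma lhs_V7: "(u, v) \<in> V7 n \<Longrightarrow> u = [X, X, Y] \<or> u = [Y, X, X]"
  by (auto simp: V7_def chain_def)

lemma lhs_V9: "(u, v) \<in> V9 n \<Longrightarrow> \<exists>i. u = [Xs i, Ys i] \<or> u = [Ys i, Xs i]"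
  by (auto simp: V9_def chain_def)

lemma lhs_V10: "(u, v) \<in> V10 n \<Longrightarrow> \<exists>i j. j \<noteq> n - i + 1 \<and> j < n \<and> (u = [Xs i, E j] \<or> u = [E j, Ys i])"
  by (auto simp: V10_def chain_def)

lemma lhs_V11: "(u, v) \<in> V11 n \<Longrightarrow> \<exists>i j. j \<noteq> i + 1 \<and> (u = [E j, Xs i] \<or> u = [Ys i, E j])"
  by (auto simp: V11_def chain_def)

lemma lhs_V12: "(u, v) \<in> V12 n \<Longrightarrow> \<exists>i. i \<noteq> 1 \<and> (u = [Xs i, X, Y] \<or> u = [X, Y, Ys i]) \<or>
    u = [X, Y, Xs i] \<or> u = [Ys i, X, Y]"
  by (auto simp: V12_def chain_def)

lemma lhs_V13: "(u, v) \<in> V13 n \<Longrightarrow> \<exists>i. u = [Y, X, Xs i] \<or> u = [Xs i, Y, X] \<or> u = [Y, X, Ys i] \<or> u = [Ys i, Y, X]"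
  by (auto simp: V13_def chain_def)

lemma lhs_V14: "(u, v) \<in> V14 n \<Longrightarrow> u = [Xs 1, X, Y] \<or> u = [X, Y, Ys 1] \<or>
    (\<exists>i. u = [Xs i, E (n - i + 1)] \<or> u = [E (i + 1), Xs i] \<or> u = [Ys i, E (i + 1)] \<or> u = [E (n - i + 1), Ys i])"
  by (auto simp: V14_def chain_def)

lemma lhs_V8: "(u, v) \<in> V8 n \<Longrightarrow> \<exists>w. u = Y # X # E 2 # w @ [X, Y]"
  using n4 by (auto simp: V8_def chain_def Es_def upt_conv_Cons)

lemmas lhs = lhs_V1 lhs_V2 lhs_V3 lhs_V4 lhs_V5 lhs_V6 lhs_V7 lhs_V8 lhs_V9 lhs_V10 lhs_V11 lhs_V12
  lhs_V13 lhs_V14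

lemma card_V1: "card (V1 n) = n - 2"
  unfolding V1_def by (subst card_UN_constant[where c = 1]) (auto simp: chain_def)

lemma card_V4: "card (V4 n) = (\<Sum>j\<in>{2..n - 1}. j - 2)"
proof -
  have "card (\<Union>i\<in>{2..<j}. chain [[E i, E j], [E j, E i]]) = j - 2" for j
    by (subst card_UN_constant[where c = 1]) (auto simp: chain_def)
  then show ?thesis
    unfolding V4_def by (subst card_UN_disjoint) (auto simp: chain_def)
qed

lemma card_V5: "card (V5 n) = (n - 2) * 2"
  unfolding V5_def by (subst card_UN_constant[where c = 2]) (auto simp: chain_def)

lemma card_V6: "card (V6 n) = n - 3"
  unfolding V6_def by (subst card_UN_constant[where c = 1]) (auto simp: chain_def)

lemma card_V2: "card V2 = 2" and card_V3: "card V3 = 1" and card_V7: "card (V7 n) = 2"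
  and card_V8: "card (V8 n) = 1"
  by (simp_all add: V2_def V3_def V7_def V8_def chain_def)

lemma m_of_pos: "1 \<le> m_of n"
  using n4 by (simp add: m_of_def)

lemma card_V9: "card (V9 n) = 2 * m_of n"
proof -
  let ?A = "\<Union>i\<in>{1..m_of n}. chain [[Xs i, Ys i], Es 2 i @ Es (i + 2) (n - 1) @ [X, Y]]"
  let ?B = "chain [[Ys 1, Xs 1], Es 2 (n - 1)]"
  let ?C = "\<Union>i\<in>{2..m_of n}. chain [[Ys i, Xs i], Es 2 (n - i) @ Es (n - i + 2) (n - 1) @ [X, Y]]"
  have "card ?A = m_of n" "card ?C = m_of n - 1"
    by (subst card_UN_constant[where c = 1]; auto simp: chain_def)+
  moreover have "card ?B = 1"
    by (simp add: chain_def)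
  moreover have "card (?A \<union> ?B) = card ?A + card ?B" "card (?A \<union> ?B \<union> ?C) = card (?A \<union> ?B) + card ?C"
    by (rule card_Un_disjoint; auto simp: chain_def)+
  ultimately have "card (V9 n) = m_of n + 1 + (m_of n - 1)"
    unfolding V9_def by (simp only:)
  then show ?thesis
    using m_of_pos by simp
qed

text \<open>For \<open>i = 1\<close> the excluded index \<open>n\<close> lies outside
  \<open>{2..n - 1}\<close> anyway, so this \<open>i\<close> contributes two relations more than
  each of the others.\<close>

lemma card_V10: "card (V10 n) = 2 * (m_of n * (n - 3) + 1)"
proof -
  let ?S = "\<lambda>i. \<Union>j\<in>{2..n - 1} - {n - i + 1}. chain [[Xs i, E j], [Xs i]] \<union> chain [[E j, Ys i], [Ys i]]"
  have S: "card (?S i) = card ({2..n - 1} - {n - i + 1}) * 2" for i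
    by (rule card_UN_constant) (auto simp: chain_def)
  have "card ({2..n - 1} - {n - i + 1}) = n - 3" if "i \<in> {2..m_of n}" for i
  proof -
    have "n - i + 1 \<in> {2..n - 1}"
      using that by (auto simp: m_of_def)
    then show ?thesis
      by simp
  qed
  then have "card (?S i) = (n - 3) * 2" if "i \<in> {2..m_of n}" for i
    using S that by simp
  then have "card (\<Union>i\<in>{2..m_of n}. ?S i) = card {2..m_of n} * ((n - 3) * 2)"
    by (intro card_UN_constant) (auto simp: chain_def)
  moreover have "card (?S 1) = (n - 2) * 2"
    using S[of 1] n4 by simp
  moreover have "card (?S 1 \<union> (\<Union>i\<in>{2..m_of n}. ?S i)) = card (?S 1) + card (\<Union>i\<in>{2..m_of n}. ?S i)"
    by (rule card_Un_disjoint) (auto simp: chain_def)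
  moreover have "{1..m_of n} = insert 1 {2..m_of n}"
    using m_of_pos by auto
  then have "V10 n = ?S 1 \<union> (\<Union>i\<in>{2..m_of n}. ?S i)"
    unfolding V10_def by (simp only: UN_insert)
  ultimately have "card (V10 n) = (n - 2) * 2 + (m_of n - 1) * ((n - 3) * 2)"
    by simp
  moreover obtain k where "m_of n = Suc k"
    using m_of_pos by (cases "m_of n") auto
  moreover have "n - 2 = Suc (n - 3)"
    using n4 by simp
  ultimately show ?thesis
    by simp
qed

lemma card_V11: "card (V11 n) = m_of n * ((n - 3) * 2)"
proof -
  have "card (\<Union>j\<in>{2..n - 1} - {i + 1}. chain [[E j, Xs i], [Xs i]] \<union> chain [[Ys i, E j], [Ys i]]) = (n - 3) * 2"
    if "i \<in> {1..m_of n}" for i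
  proof -
    \<comment> \<open>Unlike the index excluded in (V10), this one lies in the range also for
      \<open>i = 1\<close>.\<close>
    have "i + 1 \<in> {2..n - 1}"
      using that by (auto simp: m_of_def)
    then have "card ({2..n - 1} - {i + 1}) = n - 3"
      by simp
    then show ?thesis
      by (subst card_UN_constant[where c = 2]) (auto simp: chain_def)
  qed
  then show ?thesis
    unfolding V11_def by (subst card_UN_constant[where c = "(n - 3) * 2"]) (auto simp: chain_def)
qed

lemma card_V12: "card (V12 n) = (m_of n - 1) * 4 + 2"
proof -
  let ?S = "\<lambda>i. chain [[Xs i, X, Y], [X, Y, Xs i], [Xs i]] \<union> chain [[X, Y, Ys i], [Ys i, X, Y], [Ys i]]"
  let ?A = "chain [[X, Y, Xs 1], [Xs 1]]" and ?B = "chain [[Ys 1, X, Y], [Ys 1]]"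
  have "card (\<Union>i\<in>{2..m_of n}. ?S i) = card {2..m_of n} * 4"
    by (rule card_UN_constant) (auto simp: chain_def)
  moreover have "card ?A = 1" "card ?B = 1"
    by (simp_all add: chain_def)
  moreover have "card ((\<Union>i\<in>{2..m_of n}. ?S i) \<union> ?A) = card (\<Union>i\<in>{2..m_of n}. ?S i) + card ?A"
    "card ((\<Union>i\<in>{2..m_of n}. ?S i) \<union> ?A \<union> ?B) = card ((\<Union>i\<in>{2..m_of n}. ?S i) \<union> ?A) + card ?B"
    by (rule card_Un_disjoint; auto simp: chain_def)+
  ultimately have "card (V12 n) = card {2..m_of n} * 4 + 1 + 1"
    unfolding V12_def by (simp only:)
  then show ?thesis
    by simp
qed

lemma card_V13: "card (V13 n) = 4 * m_of n"
proof -
  let ?A = "chain [[Y, X, Xs 1], [Xs 1, Y, X], replicate (n - 2) X @ [E (n - 1)]]"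
  let ?B = "\<Union>i\<in>{2..m_of n}.
        chain [[Y, X, Xs i], [Xs i, Y, X],
               replicate (n - 2 * i) X @ Es (n - 2 * i + 1) (n - i) @
                 Es (n - i + 2) (n - 1) @ [X, Y]]"
  let ?C = "\<Union>i\<in>{1..m_of n}.
        chain [[Y, X, Ys i], [Ys i, Y, X],
               replicate (n - 2 * i + 1) Y @ [X] @ Es 2 i @ Es (i + 2) (2 * i)]"
  have "card ?A = 2"
    by (simp add: chain_def)
  moreover have "card ?B = card {2..m_of n} * 2" "card ?C = card {1..m_of n} * 2"
    by (rule card_UN_constant; auto simp: chain_def)+
  moreover have "card (?A \<union> ?B) = card ?A + card ?B" "card (?A \<union> ?B \<union> ?C) = card (?A \<union> ?B) + card ?C"
    by (rule card_Un_disjoint; auto simp: chain_def)+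
  ultimately have "card (V13 n) = 2 + card {2..m_of n} * 2 + card {1..m_of n} * 2"
    unfolding V13_def by (simp only:)
  then show ?thesis
    using m_of_pos by simp
qed

lemma card_V14: "card (V14 n) = 4 * m_of n"
proof -
  let ?A = "chain [[Xs 1, X, Y], [E 2, Xs 1], [Ys 1, E 2], [X, Y, Ys 1], Es 2 (n - 1) @ [X, Y]]"
  let ?B = "\<Union>i\<in>{2..m_of n}.
        chain [[Xs i, E (n - i + 1)], [E (i + 1), Xs i], [Ys i, E (i + 1)],
               [E (n - i + 1), Ys i], Es 2 (n - 1) @ [X, Y]]"
  have "card ?A = 4"
    by (simp add: chain_def)
  moreover have "card ?B = card {2..m_of n} * 4"
    by (rule card_UN_constant) (auto simp: chain_def)
  moreover have "card (?A \<union> ?B) = card ?A + card ?B"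
    by (rule card_Un_disjoint) (auto simp: chain_def)
  ultimately have "card (V14 n) = 4 + card {2..m_of n} * 4"
    unfolding V14_def by (simp only:)
  then show ?thesis
    using m_of_pos by simp
qed

lemma card_relations_sum:
  "card (relations n) = card (V1 n) + card V2 + card V3 + card (V4 n) + card (V5 n) + card (V6 n) +
     card (V7 n) + card (V8 n) + card (V9 n) + card (V10 n) + card (V11 n) + card (V12 n) +
     card (V13 n) + card (V14 n)"
proof -
  have fin: "finite (V1 n)" "finite V2" "finite V3" "finite (V4 n)" "finite (V5 n)" "finite (V6 n)"
    "finite (V7 n)" "finite (V8 n)" "finite (V9 n)" "finite (V10 n)" "finite (V11 n)" "finite (V12 n)"
    "finite (V13 n)" "finite (V14 n)"
    by (simp_all add: V1_def V2_def V3_def V4_def V5_def V6_def V7_def V8_def V9_def V10_def V11_def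
        V12_def V13_def V14_def chain_def)
  \<comment> \<open>Each family is compared with the union of its predecessors, the shape in which
    \<open>card_Un_disjoint\<close> takes the left-nested union apart.\<close>
  have d2: "V1 n \<inter> V2 = {}"
    by (rule pairs_disjointI) (auto dest!: lhs)
  have d3: "(V1 n \<union> V2) \<inter> V3 = {}"
    by (rule pairs_disjointI, elim UnE) (auto dest!: lhs)
  have d4: "(V1 n \<union> V2 \<union> V3) \<inter> V4 n = {}"
    by (rule pairs_disjointI, elim UnE) (auto dest!: lhs)
  have d5: "(V1 n \<union> V2 \<union> V3 \<union> V4 n) \<inter> V5 n = {}"
    by (rule pairs_disjointI, elim UnE) (auto dest!: lhs)
  have d6: "(V1 n \<union> V2 \<union> V3 \<union> V4 n \<union> V5 n) \<inter> V6 n = {}"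
    by (rule pairs_disjointI, elim UnE) (auto dest!: lhs)
  have d7: "(V1 n \<union> V2 \<union> V3 \<union> V4 n \<union> V5 n \<union> V6 n) \<inter> V7 n = {}"
    by (rule pairs_disjointI, elim UnE) (auto dest!: lhs)
  have d8: "(V1 n \<union> V2 \<union> V3 \<union> V4 n \<union> V5 n \<union> V6 n \<union> V7 n) \<inter> V8 n = {}"
    by (rule pairs_disjointI, elim UnE) (auto dest!: lhs)
  have d9: "(V1 n \<union> V2 \<union> V3 \<union> V4 n \<union> V5 n \<union> V6 n \<union> V7 n \<union> V8 n) \<inter> V9 n = {}"
    by (rule pairs_disjointI, elim UnE) (auto dest!: lhs)
  have d10: "(V1 n \<union> V2 \<union> V3 \<union> V4 n \<union> V5 n \<union> V6 n \<union> V7 n \<union> V8 n \<union> V9 n) \<inter> V10 n = {}"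
    by (rule pairs_disjointI, elim UnE) (auto dest!: lhs)
  have d11: "(V1 n \<union> V2 \<union> V3 \<union> V4 n \<union> V5 n \<union> V6 n \<union> V7 n \<union> V8 n \<union> V9 n \<union> V10 n) \<inter> V11 n = {}"
    by (rule pairs_disjointI, elim UnE) (auto dest!: lhs)
  have d12: "(V1 n \<union> V2 \<union> V3 \<union> V4 n \<union> V5 n \<union> V6 n \<union> V7 n \<union> V8 n \<union> V9 n \<union> V10 n \<union> V11 n) \<inter> V12 n = {}"
    by (rule pairs_disjointI, elim UnE) (auto dest!: lhs)
  have d13: "(V1 n \<union> V2 \<union> V3 \<union> V4 n \<union> V5 n \<union> V6 n \<union> V7 n \<union> V8 n \<union> V9 n \<union> V10 n \<union> V11 n \<union> V12 n) \<inter> V13 n = {}"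
    by (rule pairs_disjointI, elim UnE) (auto dest!: lhs)
  have d14: "(V1 n \<union> V2 \<union> V3 \<union> V4 n \<union> V5 n \<union> V6 n \<union> V7 n \<union> V8 n \<union> V9 n \<union> V10 n \<union> V11 n \<union> V12 n \<union> V13 n) \<inter> V14 n = {}"
    by (rule pairs_disjointI, elim UnE) (auto dest!: lhs)
  show ?thesis
    unfolding relations_def by (simp only: card_Un_disjoint fin finite_UnI d2 d3 d4 d5 d6 d7 d8 d9 d10 d11 d12 d13 d14)
qed

end

section \<open>The two counting formulas\<close>

lemma sum_minus_2: "2 * (\<Sum>j\<in>{2..k + 1}. j - 2) = k * (k - 1 :: nat)"
proof (induction k)
  case (Suc k)
  have "{2..Suc k + 1} = insert (k + 2) {2..k + 1}"
    by auto
  then have "2 * (\<Sum>j\<in>{2..Suc k + 1}. j - 2) = 2 * k + k * (k - 1)"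
    using Suc by simp
  then show ?case
    by (cases k) simp_all
qed simp

lemma card_alphabet:
  assumes "4 \<le> n"
  shows "card (alphabet n) = n + 2 * m_of n"
proof -
  have "card (E ` {2..n - 1}) = n - 2" "card (Xs ` {1..m_of n}) = m_of n" "card (Ys ` {1..m_of n}) = m_of n"
    by (simp_all add: card_image inj_on_def)
  moreover have "card ({X, Y} \<union> E ` {2..n - 1}) = 2 + card (E ` {2..n - 1})"
    "card ({X, Y} \<union> E ` {2..n - 1} \<union> Xs ` {1..m_of n}) = card ({X, Y} \<union> E ` {2..n - 1}) + card (Xs ` {1..m_of n})"
    "card ({X, Y} \<union> E ` {2..n - 1} \<union> Xs ` {1..m_of n} \<union> Ys ` {1..m_of n}) =
      card ({X, Y} \<union> E ` {2..n - 1} \<union> Xs ` {1..m_of n}) + card (Ys ` {1..m_of n})"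
    by (subst card_Un_disjoint; auto)+
  ultimately have "card (alphabet n) = 2 + (n - 2) + m_of n + m_of n"
    unfolding alphabet_def by (simp only:)
  then show ?thesis
    using assms by simp
qed

text \<open>The parity evaluates \<open>(-1) ^ n\<close>, and the offsets 4 and 5 make every
  truncated subtraction in the counts an exact one.\<close>

lemma parity_cases:
  assumes "4 \<le> n"
  obtains q where "n = 2 * q + 4" "m_of n = q + 1" | q where "n = 2 * q + 5" "m_of n = q + 2"
proof (cases "even n")
  case True
  then obtain p where "n = 2 * p"
    by (auto elim: evenE)
  then have "n = 2 * (p - 2) + 4" "m_of n = (p - 2) + 1"
    using assms by (auto simp: m_of_def)
  then show ?thesis
    by (rule that(1))
next
  case False
  then obtain p where "n = 2 * p + 1"
    by (auto elim: oddE)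
  then have "n = 2 * (p - 2) + 5" "m_of n = (p - 2) + 2"
    using assms by (auto simp: m_of_def)
  then show ?thesis
    by (rule that(2))
qed

lemma real_card_alphabet:
  assumes "4 \<le> n"
  shows "real (card (alphabet n)) = 2 * real n - (3 + (-1) ^ n) / 2"
  using assms
proof (cases rule: parity_cases)
  case (1 q)
  show ?thesis
    unfolding card_alphabet[OF assms] 1(2) by (simp add: 1(1))
next
  case (2 q)
  show ?thesis
    unfolding card_alphabet[OF assms] 2(2) by (simp add: 2(1))
qed

text \<open>Doubled because (V4) contributes the triangular number
  \<open>(n - 2) * (n - 3) / 2\<close>.\<close>

lemma card_relations:
  assumes "4 \<le> n"
  shows "2 * card (relations n) = 2 * (n - 2) + 6 + (n - 2) * (n - 3) + 4 * (n - 2) + 2 * (n - 3) + 6 +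
     4 * m_of n + 4 * (m_of n * (n - 3) + 1) + 4 * (m_of n * (n - 3)) + 8 * (m_of n - 1) + 4 +
     16 * m_of n"
proof -
  have "n - 1 = (n - 2) + 1" "n - 2 - 1 = n - 3"
    using assms by simp_all
  then have "2 * card (V4 n) = (n - 2) * (n - 3)"
    using sum_minus_2[of "n - 2"] by (simp only: card_V4[OF assms])
  then show ?thesis
    unfolding card_relations_sum[OF assms] card_V1[OF assms] card_V2[OF assms] card_V3[OF assms] card_V5[OF assms] card_V6[OF assms]
      card_V7[OF assms] card_V8[OF assms] card_V9[OF assms] card_V10[OF assms] card_V11[OF assms]
      card_V12[OF assms] card_V13[OF assms] card_V14[OF assms]
    by simp
qed

lemma real_card_relations:
  assumes "4 \<le> n"
  shows "real (card (relations n)) =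
    1 / 2 * (5 * real n ^ 2 - (1 + 2 * (-1) ^ n) * real n + (-1) ^ (n + 1) - 3)"
proof -
  have eq: "real (card (relations n)) = real (2 * card (relations n)) / 2"
    by simp
  show ?thesis
    using assms
  proof (cases rule: parity_cases)
    case (1 q)
    have "n - 2 = 2 * q + 2" "n - 3 = 2 * q + 1" "m_of n - 1 = q"
      using 1 by simp_all
    then show ?thesis
      unfolding eq card_relations[OF assms] 1(2)
      by (simp add: 1(1) power2_eq_square field_simps)
  next
    case (2 q)
    have "n - 2 = 2 * q + 3" "n - 3 = 2 * q + 2" "m_of n - 1 = q + 1"
      using 2 by simp_all
    then show ?thesis
      unfolding eq card_relations[OF assms] 2(2)
      by (simp add: 2(1) power2_eq_square field_simps)
  qed
qed

section \<open>The presentation\<close>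

lemma replicate_lists: "b \<in> B \<Longrightarrow> replicate k b \<in> lists B"
  by (induction k) auto

lemma letters_alphabet [simp]:
  "X \<in> alphabet n" "Y \<in> alphabet n"
  "E j \<in> alphabet n \<longleftrightarrow> j \<in> {2..n - 1}"
  "Xs i \<in> alphabet n \<longleftrightarrow> i \<in> {1..m_of n}"
  "Ys i \<in> alphabet n \<longleftrightarrow> i \<in> {1..m_of n}"
  by (auto simp: alphabet_def)

lemma relations_subset:
  assumes n4: "4 \<le> n"
  shows "relations n \<subseteq> lists (alphabet n) \<times> lists (alphabet n)"
proof -
  have m: "i \<le> m_of n \<longleftrightarrow> 2 * i < n" for i
    using n4 by (auto simp: m_of_def)
  note simps = chain_def m set_Es
  have "V1 n \<subseteq> lists (alphabet n) \<times> lists (alphabet n)" "V2 \<subseteq> lists (alphabet n) \<times> lists (alphabet n)"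
    "V3 \<subseteq> lists (alphabet n) \<times> lists (alphabet n)" "V4 n \<subseteq> lists (alphabet n) \<times> lists (alphabet n)"
    "V5 n \<subseteq> lists (alphabet n) \<times> lists (alphabet n)" "V6 n \<subseteq> lists (alphabet n) \<times> lists (alphabet n)"
    "V7 n \<subseteq> lists (alphabet n) \<times> lists (alphabet n)" "V8 n \<subseteq> lists (alphabet n) \<times> lists (alphabet n)"
    using n4 by (auto simp: V1_def V2_def V3_def V4_def V5_def V6_def V7_def V8_def simps)
  moreover have "V9 n \<subseteq> lists (alphabet n) \<times> lists (alphabet n)"
    "V10 n \<subseteq> lists (alphabet n) \<times> lists (alphabet n)" "V11 n \<subseteq> lists (alphabet n) \<times> lists (alphabet n)"
    "V12 n \<subseteq> lists (alphabet n) \<times> lists (alphabet n)"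
    using n4 by (auto simp: V9_def V10_def V11_def V12_def simps) linarith+
  moreover have "V13 n \<subseteq> lists (alphabet n) \<times> lists (alphabet n)"
    "V14 n \<subseteq> lists (alphabet n) \<times> lists (alphabet n)"
    using n4 by (auto simp: V13_def V14_def simps) linarith+
  ultimately show ?thesis
    unfolding relations_def by (intro Un_least)
qed

lemma normal_words_lists:
  assumes "4 \<le> n" "u \<in> trans_words n \<union> flip_words n"
  shows "u \<in> lists (alphabet n)"
proof -
  have "idem_word n j \<in> lists (alphabet n)" if "j \<in> {1..n}" for j
    using that by (auto simp: idem_word_def)
  then have idem: "concat (map (idem_word n) l) \<in> lists (alphabet n)" if "set l \<subseteq> {1..n}" for l
    using that by (induction l) (auto simp: append_in_lists_conv)
  have flip: "flip_letter n d \<in> alphabet n" if "1 \<le> d" "d < n" "2 * d \<noteq> n" for d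
    using that by (auto simp: flip_letter_def m_of_def)
  consider (up) l k where "u = up_word n l k" "set l \<subseteq> {1..n}"
    | (down) l k where "u = down_word n l k" "set l \<subseteq> {1..n}"
    | (flip) a d c where "u = flip_word n a d c" "1 \<le> d" "2 * d \<noteq> n" "a + d < n"
    using assms(2) by (auto simp: trans_words_def flip_words_def)
  then show ?thesis
  proof cases
    case up
    then show ?thesis
      by (simp add: up_word_def append_in_lists_conv replicate_lists idem)
  next
    case down
    then show ?thesis
      by (simp add: down_word_def append_in_lists_conv replicate_lists idem)
  next
    case (flip a d c)
    then show ?thesis
      using \<open>\<And>d. _ \<Longrightarrow> _ \<Longrightarrow> _ \<Longrightarrow> flip_letter n d \<in> alphabet n\<close>[of d]
      by (simp add: flip_word_def append_in_lists_conv replicate_lists)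
  qed
qed

lemma generated_congruence_least:
  "is_congruence B r \<Longrightarrow> V \<subseteq> r \<Longrightarrow> generated_congruence B V \<subseteq> r"
  unfolding generated_congruence_def by blast

text \<open>Soundness: the kernel of \<open>val\<close> is a congruence that contains the relations.
  Completeness: both words are congruent to normal forms, which by soundness still represent the
  same map and so have equal values by \<open>ev_normal_cong\<close>.\<close>

lemma generated_congruence_relations:
  assumes n4: "4 \<le> n" and uv: "u \<in> lists (alphabet n)" "v \<in> lists (alphabet n)"
  shows "(u, v) \<in> generated_congruence (alphabet n) (relations n) \<longleftrightarrow> val n u = val n v"
proof
  let ?B = "alphabet n" and ?r = "generated_congruence (alphabet n) (relations n)"
  let ?k = "{(u, v). u \<in> lists ?B \<and> v \<in> lists ?B \<and> val n u = val n v}"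
  have "is_congruence ?B ?k"
    unfolding is_congruence_def equiv_def refl_on_def sym_def trans_def
    by (auto simp: val_append_comp)
  moreover have "relations n \<subseteq> ?k"
    using relations_subset[OF n4] val_relations[OF n4] by blast
  ultimately have sound: "val n u = val n v" if "(u, v) \<in> ?r" for u v
    using generated_congruence_least that by blast
  then show "(u, v) \<in> ?r \<Longrightarrow> val n u = val n v"
    by blast
  assume eq: "val n u = val n v"
  obtain \<phi> :: "letter \<Rightarrow> letter list set endo"
    where \<phi>: "\<And>u v. u \<in> lists ?B \<Longrightarrow> v \<in> lists ?B \<Longrightarrow>
      (u, v) \<in> ?r \<longleftrightarrow> prod_list (map \<phi> u) = prod_list (map \<phi> v)"
    using congruence_faithful_representation[OF is_congruence_generated[OF relations_subset[OF n4]]]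
    by blast
  \<comment> \<open>From here on \<open>ev\<close> is evaluation in a faithful copy of the presented
    monoid.\<close>
  interpret ODI_relations n \<phi>
  proof
    fix u v assume "(u, v) \<in> relations n"
    moreover from this have "(u, v) \<in> ?r"
      unfolding generated_congruence_def by blast
    ultimately show "prod_list (map \<phi> u) = prod_list (map \<phi> v)"
      using \<phi> relations_subset[OF n4] by blast
  qed (rule n4)
  have ev: "(u, v) \<in> ?r \<longleftrightarrow> ev u = ev v" if "u \<in> lists ?B" "v \<in> lists ?B" for u v
    using \<phi>[OF that] by (simp add: ev_def)
  obtain u' where u': "u' \<in> trans_words n \<union> flip_words n" "ev u = ev u'"
    using normal_form[OF uv(1)] by blast
  obtain v' where v': "v' \<in> trans_words n \<union> flip_words n" "ev v = ev v'"
    using normal_form[OF uv(2)] by blast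
  have "val n u = val n u'" "val n v = val n v'"
    using sound ev uv u' v' normal_words_lists[OF n4] by blast+
  then have "ev u' = ev v'"
    using ev_normal_cong[OF u'(1) v'(1)] eq by simp
  then show "(u, v) \<in> ?r"
    using ev uv u'(2) v'(2) by simp
qed

lemma monoid_ODI: "monoid (ODI n)"
proof (rule monoidI)
  fix \<alpha> \<beta> \<gamma>
  show "\<alpha> \<otimes>\<^bsub>ODI n\<^esub> \<beta> \<otimes>\<^bsub>ODI n\<^esub> \<gamma> = \<alpha> \<otimes>\<^bsub>ODI n\<^esub> (\<beta> \<otimes>\<^bsub>ODI n\<^esub> \<gamma>)"
    by (auto simp: ODI_simps map_comp_def fun_eq_iff split: option.splits)
next
  show "\<one>\<^bsub>ODI n\<^esub> \<in> carrier (ODI n)"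
    unfolding ODI_simps by (rule val_ODI) simp
next
  fix \<alpha> assume "\<alpha> \<in> carrier (ODI n)"
  \<comment> \<open>Representing \<open>\<alpha>\<close> by a word reduces the identity laws to
    concatenation with the empty word.\<close>
  then obtain w where w: "val n w = \<alpha>"
    using ODI_normal_word by blast
  show "\<one>\<^bsub>ODI n\<^esub> \<otimes>\<^bsub>ODI n\<^esub> \<alpha> = \<alpha>" "\<alpha> \<otimes>\<^bsub>ODI n\<^esub> \<one>\<^bsub>ODI n\<^esub> = \<alpha>"
    unfolding ODI_simps w[symmetric] val_append_comp[symmetric] by simp_all
qed (simp add: ODI_simps ODI_comp)

lemma ODI_presentation:
  assumes n4: "4 \<le> n"
  shows "ODI n \<cong> presented_monoid (alphabet n) (relations n)"
proof -
  let ?B = "alphabet n" and ?r = "generated_congruence (alphabet n) (relations n)"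
  have sub: "relations n \<subseteq> lists ?B \<times> lists ?B"
    by (rule relations_subset[OF n4])
  have equiv: "equiv (lists ?B) ?r"
    using is_congruence_generated[OF sub] by (simp add: is_congruence_def)
  have eq_iff: "?r `` {u} = ?r `` {v} \<longleftrightarrow> val n u = val n v" if "u \<in> lists ?B" "v \<in> lists ?B" for u v
    using generated_congruence_relations[OF n4 that] eq_equiv_class_iff[OF equiv that] by simp
  have "\<exists>w. w \<in> lists ?B \<and> val n w = \<alpha>" if "\<alpha> \<in> carrier (ODI n)" for \<alpha>
    using ODI_normal_word[OF that] normal_words_lists[OF n4] by blast
  then obtain word where word: "\<And>\<alpha>. \<alpha> \<in> carrier (ODI n) \<Longrightarrow> word \<alpha> \<in> lists ?B"
    "\<And>\<alpha>. \<alpha> \<in> carrier (ODI n) \<Longrightarrow> val n (word \<alpha>) = \<alpha>"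
    by metis
  \<comment> \<open>By \<open>eq_iff\<close> the class does not depend on which word represents
    \<open>\<alpha>\<close>.\<close>
  define h where "h \<alpha> = ?r `` {word \<alpha>}" for \<alpha>
  have carrier: "carrier (presented_monoid ?B (relations n)) = lists ?B // ?r"
    by (simp add: presented_monoid_def)
  have "h \<in> iso (ODI n) (presented_monoid ?B (relations n))"
    unfolding iso_iff
  proof (intro conjI)
    show "h \<in> hom (ODI n) (presented_monoid ?B (relations n))"
    proof (rule homI)
      fix \<alpha> assume "\<alpha> \<in> carrier (ODI n)"
      then show "h \<alpha> \<in> carrier (presented_monoid ?B (relations n))"
        unfolding carrier h_def using word(1) by (intro quotientI)
    next
      fix \<alpha> \<beta> assume \<alpha>\<beta>: "\<alpha> \<in> carrier (ODI n)" "\<beta> \<in> carrier (ODI n)"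
      then have comp: "\<beta> \<circ>\<^sub>m \<alpha> \<in> carrier (ODI n)"
        by (rule ODI_comp)
      have "?r `` {word (\<beta> \<circ>\<^sub>m \<alpha>)} = ?r `` {word \<alpha> @ word \<beta>}"
        using word \<alpha>\<beta> comp by (subst eq_iff) (simp_all add: val_append_comp)
      then show "h (\<alpha> \<otimes>\<^bsub>ODI n\<^esub> \<beta>) = h \<alpha> \<otimes>\<^bsub>presented_monoid ?B (relations n)\<^esub> h \<beta>"
        using mult_presented_monoid[OF sub word(1)[OF \<alpha>\<beta>(1)] word(1)[OF \<alpha>\<beta>(2)]]
        by (simp add: h_def ODI_simps)
    qed
    show "h ` carrier (ODI n) = carrier (presented_monoid ?B (relations n))"
    proof (intro equalityI subsetI)
      fix C assume "C \<in> carrier (presented_monoid ?B (relations n))"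
      then obtain w where w: "w \<in> lists ?B" "C = ?r `` {w}"
        unfolding carrier by (rule quotientE)
      then have "h (val n w) = C"
        unfolding h_def w(2) using word val_ODI[OF w(1)] by (subst eq_iff) simp_all
      then show "C \<in> h ` carrier (ODI n)"
        using val_ODI[OF w(1)] by blast
    next
      fix C assume "C \<in> h ` carrier (ODI n)"
      then show "C \<in> carrier (presented_monoid ?B (relations n))"
        unfolding carrier h_def using word(1) by (auto intro: quotientI)
    qed
    show "inj_on h (carrier (ODI n))"
    proof (rule inj_onI)
      fix \<alpha> \<beta> assume \<alpha>\<beta>: "\<alpha> \<in> carrier (ODI n)" "\<beta> \<in> carrier (ODI n)" and "h \<alpha> = h \<beta>"
      then have "val n (word \<alpha>) = val n (word \<beta>)"
        using eq_iff[OF word(1)[OF \<alpha>\<beta>(1)] word(1)[OF \<alpha>\<beta>(2)]] by (simp add: h_def)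
      then show "\<alpha> = \<beta>"
        using word(2) \<alpha>\<beta> by simp
    qed
  qed
  then show ?thesis
    by (rule is_isoI)
qed

theorem theorem3p9:
  fixes n :: nat
  assumes "n \<ge> 4"
  shows "real (card (alphabet n)) = 2 * real n - (3 + (-1) ^ n) / 2 \<and>
         real (card (relations n)) =
           1 / 2 * (5 * real n ^ 2 - (1 + 2 * (-1) ^ n) * real n + (-1) ^ (n + 1) - 3) \<and>
         defined_by_presentation (ODI n) (alphabet n) (relations n)"
  unfolding defined_by_presentation_def
  using real_card_alphabet real_card_relations monoid_ODI relations_subset ODI_presentation assms
  by blast

end
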